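(* The following statements hold. (1) If $(\mathbf{x}^{\mathbf{a}_1},\dots,\mathbf{x}^{\mathbf{a}_d})$ is a reduction ideal of $\mathfrak{m}$, then it is a minimal reduction ideal of $\mathfrak{m}$. (2) If $\mathbb{K}$ is an infinite field, then the only possible monomial minimal reduction ideal of $\mathfrak{m}$ is $(\mathbf{x}^{\mathbf{a}_1},\dots,\mathbf{x}^{\mathbf{a}_d})$; that is, if $J$ is a monomial ideal of $R$ which is a minimal reduction ideal of $\mathfrak{m}$, then $J=(\mathbf{x}^{\mathbf{a}_1},\dots,\mathbf{x}^{\mathbf{a}_d})$.
   Context: Let $d\ge 1$, let $\mathbb{N}$ be the set of non-negative integers, and let $S\subseteq\mathbb{N}^d$ be an affine (finitely generated) semigroup containing $\mathbf 0$, fully embedded in $\mathbb{N}^d$ (i.e. of dimension $d$: $S$ spans $\mathbb{R}^d$), and simplicial: the cone $\mathrm{cone}(S)\subseteq\mathbb{R}^d_{\ge0}$ of non-negative real combinations of elements of $S$ has exactly $d$ extremal rays. Its minimal generating set is $\{\mathbf{a}_1,\dots,\mathbf{a}_{d+s}\}$, where $\mathbf{a}_1,\dots,\mathbf{a}_d$ are the extremal rays of $S$, i.e. the smallest nonzero elements of $S$ lying on each of the $d$ extremal rays of the cone. Let $\mathbb{K}$ be a field. For $\mathbf a=(a_1,\dots,a_d)\in\mathbb{N}^d$ put $\mathbf{x}^{\mathbf{a}}=x_1^{a_1}\cdots x_d^{a_d}$. Let $R=\mathbb{K}[S]=\mathbb{K}[\mathbf{x}^{\mathbf{a}_1},\dots,\mathbf{x}^{\mathbf{a}_{d+s}}]\subseteq\mathbb{K}[x_1,\dots,x_d]$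 and $\mathfrak{m}=(\mathbf{x}^{\mathbf{a}_1},\dots,\mathbf{x}^{\mathbf{a}_{d+s}})$. A monomial ideal of $R$ is an ideal generated by monomials $\mathbf{x}^{\mathbf{a}}$ with $\mathbf{a}\in S$. An ideal $J\subseteq\mathfrak{m}$ of $R$ is a reduction ideal of $\mathfrak{m}$ if $\mathfrak{m}^{n+1}=J\mathfrak{m}^n$ for $n\gg0$; it is a minimal reduction ideal if it is minimal among reduction ideals with respect to inclusion. *)

theory Defs
  imports
    "HOL-Analysis.Analysis"
    "HOL-Library.Poly_Mapping"
    "HOL-Algebra.Ideal_Product"
    "HOL-Algebra.Generated_Rings"
begin

definition submonoid_add :: "'a::monoid_add set \<Rightarrow> bool" where
  "submonoid_add M \<longleftrightarrow> 0 \<in> M \<and> (\<forall>x\<in>M. \<forall>y\<in>M. x + y \<in> M)"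

definition affine_semigroup :: "(nat ^ 'd) set \<Rightarrow> bool" where
  "affine_semigroup S \<longleftrightarrow> (\<exists>A. finite A \<and> S = submonoid_add hull A)"

definition minimal_generating_set :: "'a::monoid_add set \<Rightarrow> 'a set \<Rightarrow> bool" where
  "minimal_generating_set S A \<longleftrightarrow>
     submonoid_add hull A = S \<and> (\<forall>B. B \<subset> A \<longrightarrow> submonoid_add hull B \<noteq> S)"

definition real_vec :: "nat ^ 'd \<Rightarrow> real ^ 'd" where
  "real_vec v = (\<chi> i. real (v $ i))"

definition fully_embedded :: "(nat ^ 'd) set \<Rightarrow> bool" where
  "fully_embedded S \<longleftrightarrow> span (real_vec ` S) = UNIV"

definition semigroup_cone :: "(nat ^ 'd) set \<Rightarrow> (real ^ 'd) set" where
  "semigroup_cone S = convex_cone hull (real_vec ` S)"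

definition extremal_ray :: "'a::real_vector set \<Rightarrow> 'a set \<Rightarrow> bool" where
  "extremal_ray C F \<longleftrightarrow> F face_of C \<and> (\<exists>v. v \<noteq> 0 \<and> F = conic hull {v})"

definition simplicial_semigroup :: "(nat ^ 'd) set \<Rightarrow> bool" where
  "simplicial_semigroup S \<longleftrightarrow> card {F. extremal_ray (semigroup_cone S) F} = CARD('d)"

text \<open>
  The order on exponent vectors is componentwise. It is total on the lattice points of a ray in
  the non-negative orthant, so \<open>b \<le> c\<close> for all \<open>c\<close> on the ray says that \<open>b\<close> is the one closest
  to the origin.
\<close>

definition extremal_ray_generators :: "(nat ^ 'd) set \<Rightarrow> (nat ^ 'd) set" where
  "extremal_ray_generators S =
     {b \<in> S. b \<noteq> 0 \<and> (\<exists>F. extremal_ray (semigroup_cone S) F \<and> real_vec b \<in> F \<and>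
        (\<forall>c\<in>S. c \<noteq> 0 \<and> real_vec c \<in> F \<longrightarrow> b \<le> c))}"

text \<open>
  The polynomial ring \<open>K[x\<^sub>1, \<dots>, x\<^sub>d]\<close> is the type \<open>(nat ^ 'd) \<Rightarrow>\<^sub>0 'k\<close> of finitely supported
  functions on exponent vectors, whose multiplication is convolution; \<open>poly_ring\<close> is the
  corresponding ring record.
\<close>

definition poly_ring :: "((nat ^ 'd) \<Rightarrow>\<^sub>0 'k::field) ring" where
  "poly_ring = \<lparr>carrier = UNIV, mult = (*), one = 1, zero = 0, add = (+)\<rparr>"

definition monomial :: "nat ^ 'd \<Rightarrow> ((nat ^ 'd) \<Rightarrow>\<^sub>0 'k::field)" where
  "monomial b = Poly_Mapping.single b 1"

definition constants :: "((nat ^ 'd) \<Rightarrow>\<^sub>0 'k::field) set" where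
  "constants = {Poly_Mapping.single 0 c | c. True}"

text \<open>The subalgebra \<open>K[x\<^sup>b : b \<in> A]\<close> of the polynomial ring.\<close>

definition monomial_algebra :: "(nat ^ 'd) set \<Rightarrow> ((nat ^ 'd) \<Rightarrow>\<^sub>0 'k::field) ring" where
  "monomial_algebra A =
     poly_ring\<lparr>carrier := generate_ring poly_ring (constants \<union> monomial ` A)\<rparr>"

definition monomial_ideal ::
    "(nat ^ 'd) set \<Rightarrow> ((nat ^ 'd) \<Rightarrow>\<^sub>0 'k::field) ring \<Rightarrow> ((nat ^ 'd) \<Rightarrow>\<^sub>0 'k) set \<Rightarrow> bool" where
  "monomial_ideal S R J \<longleftrightarrow> (\<exists>B\<subseteq>S. J = Idl\<^bsub>R\<^esub> (monomial ` B))"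

definition reduction_ideal :: "('a, 'b) ring_scheme \<Rightarrow> 'a set \<Rightarrow> 'a set \<Rightarrow> bool" where
  "reduction_ideal R I J \<longleftrightarrow> ideal J R \<and> J \<subseteq> I \<and>
     (\<forall>\<^sub>F n in sequentially.
        I [^]\<^bsub>ideals_set R\<^esub> (n + 1) = J \<cdot>\<^bsub>R\<^esub> (I [^]\<^bsub>ideals_set R\<^esub> n))"

definition minimal_reduction_ideal :: "('a, 'b) ring_scheme \<Rightarrow> 'a set \<Rightarrow> 'a set \<Rightarrow> bool" where
  "minimal_reduction_ideal R I J \<longleftrightarrow> reduction_ideal R I J \<and>
     (\<forall>J'. reduction_ideal R I J' \<and> J' \<subseteq> J \<longrightarrow> J' = J)"

end

theory Submission
  imports Defs
begin

text \<open>
  Write \<open>\<alpha> i\<close> for the extremal generators, \<open>E\<close> for the ideal generated by the monomials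
  \<open>x^(\<alpha> i)\<close>, and \<open>m\<close> for the ideal spanned by all non-constant monomials. Every ideal spanned by
  monomials is determined by its set of exponents, and products of such ideals correspond to sums of
  exponent sets; so the powers of \<open>m\<close> are recorded by the sets \<open>nfold_sums S n\<close> of those
  exponents that are sums containing at least \<open>n\<close> nonzero summands.

  The geometric input is that the \<open>\<alpha> i\<close> generate the cone of \<open>S\<close> (Krein and Milman, applied to a
  compact cross-section of the cone) and are linearly independent (there are as many as the dimension,
  and they span). Hence a positive multiple \<open>M\<close> of every exponent \<open>b\<close> is a unique combination
  \<open>\<Sum> q b i \<alpha> i\<close> with natural coefficients; \<open>weight b = \<Sum> q b i\<close> is additive, and
  \<open>weight (\<alpha> i) = M\<close>.

  Minimality of \<open>E\<close>, \<open>rays_ideal_minimal\<close>. If \<open>E\<close> is a reduction, every exponent of \<open>m^n\<close> has weight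
  at least \<open>n M\<close>, for otherwise large multiples of it would violate \<open>m^(n+k) = E^k m^n\<close>. Let
  \<open>J \<subseteq> E\<close> be a reduction and look at the vectors of coefficients at \<open>\<alpha> 1, \<dots>, \<alpha> d\<close> of its
  elements. If they fill the whole space, then \<open>J + m E = E\<close>, and \<open>J = E\<close> follows as in Nakayama's
  lemma since \<open>J\<close> contains a power of \<open>m\<close>. Otherwise some \<open>c \<noteq> 0\<close> annihilates all of them.
  Evaluation of the polynomial subring \<open>K[x^(\<alpha> 1), \<dots>, x^(\<alpha> d)]\<close> at the point \<open>c\<close>, restricted to the
  least possible weight \<open>n M\<close> and extended by zero to the other monomials, is compatible with the
  products that occur in \<open>J m^n\<close>. It kills \<open>J m^n = m^(n+1)\<close> but not the powers of the \<open>x^(\<alpha> i)\<close> with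
  \<open>c i \<noteq> 0\<close>, a contradiction.

  Uniqueness, \<open>monomial_minimal_reduction_eq_rays_ideal\<close>. Let \<open>J\<close> be a reduction spanned by monomials.
  Since \<open>(n + 1) \<alpha> i\<close> is a sum of \<open>n + 1\<close> nonzero exponents only in the obvious way, \<open>J\<close> contains
  every \<open>x^(\<alpha> i)\<close>, so \<open>E \<subseteq> J\<close>. If \<open>J \<noteq> E\<close>, choose a smallest exponent \<open>c\<close> of \<open>J\<close> outside
  \<open>E\<close>; then \<open>x^c\<close> is not in \<open>m J\<close>. A strictly smaller reduction arises by dropping \<open>x^c\<close> from \<open>J\<close>
  if \<open>weight c \<ge> M\<close>, or by replacing \<open>x^c\<close> and the \<open>x^(\<alpha> i)\<close> by the differences
  \<open>x^(\<alpha> i) - x^c\<close> if \<open>weight c < M\<close>. In both cases the relation \<open>M c = \<Sum> q c i \<alpha> i\<close> shows that a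
  power of \<open>x^c\<close> is redundant; this is \<open>hyperplane_ideal_reduction\<close>. So \<open>J\<close> is not a minimal
  reduction.
\<close>

section \<open>Ideals of the semigroup ring spanned by monomials\<close>

abbreviation coeff :: "('a \<Rightarrow>\<^sub>0 'b::zero) \<Rightarrow> 'a \<Rightarrow> 'b" where
  "coeff \<equiv> Poly_Mapping.lookup"

definition monomial_span :: "(nat ^ 'd) set \<Rightarrow> ((nat ^ 'd) \<Rightarrow>\<^sub>0 'k::field) set" where
  "monomial_span T = {f. Poly_Mapping.keys f \<subseteq> T}"

definition semigroup_algebra :: "(nat ^ 'd) set \<Rightarrow> ((nat ^ 'd) \<Rightarrow>\<^sub>0 'k::field) ring" where
  "semigroup_algebra S = poly_ring\<lparr>carrier := monomial_span S\<rparr>"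

lemma semigroup_algebra_simps [simp]:
  "carrier (semigroup_algebra S) = monomial_span S"
  "mult (semigroup_algebra S) = (*)" "one (semigroup_algebra S) = 1"
  "zero (semigroup_algebra S) = 0" "add (semigroup_algebra S) = (+)"
  by (simp_all add: semigroup_algebra_def poly_ring_def)

lemma in_monomial_span_iff: "f \<in> monomial_span T \<longleftrightarrow> (\<forall>b. coeff f b \<noteq> 0 \<longrightarrow> b \<in> T)"
  by (auto simp: monomial_span_def in_keys_iff)

lemma monomial_span_mono: "T \<subseteq> U \<Longrightarrow> monomial_span T \<subseteq> monomial_span U"
  by (auto simp: monomial_span_def)

lemma single_in_monomial_span: "b \<in> T \<Longrightarrow> Poly_Mapping.single b c \<in> monomial_span T"
  by (simp add: monomial_span_def)

lemma monomial_in_monomial_span_iff [simp]: "monomial b \<in> monomial_span T \<longleftrightarrow> b \<in> T"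
  by (simp add: monomial_span_def monomial_def)

lemma coeff_monomial: "coeff (monomial b) c = (if b = c then 1 else 0)"
  by (simp add: monomial_def lookup_single when_def)

lemma monomial_add: "monomial (b + c) = monomial b * monomial c"
  by (simp add: monomial_def mult_single)

lemma monomial_span_subset_iff: "monomial_span T \<subseteq> monomial_span U \<longleftrightarrow> T \<subseteq> U"
  by (metis monomial_in_monomial_span_iff monomial_span_mono subsetD subsetI)

lemma submonoid_add_monomial_span: "submonoid_add (monomial_span T)"
  unfolding submonoid_add_def monomial_span_def using keys_add by fastforce

lemma uminus_in_monomial_span: "f \<in> monomial_span T \<Longrightarrow> - f \<in> monomial_span T"
  by (simp add: in_monomial_span_iff)

lemma times_in_monomial_span:
  "f \<in> monomial_span T \<Longrightarrow> g \<in> monomial_span U \<Longrightarrow> f * g \<in> monomial_span (T + U)"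
  using keys_mult[of f g] by (fastforce simp: monomial_span_def set_plus_def)

lemma poly_mapping_eq_sum_single:
  "f = (\<Sum>b\<in>Poly_Mapping.keys f. Poly_Mapping.single b (coeff f b))"
proof (rule poly_mapping_eqI)
  fix k
  show "coeff f k = coeff (\<Sum>b\<in>Poly_Mapping.keys f. Poly_Mapping.single b (coeff f b)) k"
    by (simp add: lookup_sum lookup_single when_def in_keys_iff)
qed

lemma submonoid_add_hull: "submonoid_add (submonoid_add hull A)"
  by (rule hull_in) (auto simp: submonoid_add_def)

lemma submonoid_add_sum:
  fixes f :: "'i \<Rightarrow> 'b::comm_monoid_add"
  assumes "submonoid_add P" "\<And>i. i \<in> I \<Longrightarrow> f i \<in> P"
  shows "sum f I \<in> P"
  using assms by (induction I rule: infinite_finite_induct) (auto simp: submonoid_add_def)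

lemma monomial_span_subsetI:
  fixes P :: "((nat ^ 'd) \<Rightarrow>\<^sub>0 'k::field) set"
  assumes "submonoid_add P" "\<And>b c. b \<in> T \<Longrightarrow> Poly_Mapping.single b c \<in> P"
  shows "monomial_span T \<subseteq> P"
proof
  fix f :: "(nat ^ 'd) \<Rightarrow>\<^sub>0 'k" assume f: "f \<in> monomial_span T"
  show "f \<in> P"
    by (subst poly_mapping_eq_sum_single, rule submonoid_add_sum[OF assms(1)])
       (use f assms(2) in \<open>auto simp: monomial_span_def\<close>)
qed

lemma submonoid_add_plus_absorb:
  assumes "submonoid_add S"
  shows "S + S = S"
  using assms unfolding submonoid_add_def set_plus_def by (force intro: exI[of _ 0])

lemma cring_semigroup_algebra:
  assumes "submonoid_add S"
  shows "cring (semigroup_algebra S :: ((nat ^ 'd) \<Rightarrow>\<^sub>0 'k::field) ring)"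
proof (rule cringI)
  let ?R = "semigroup_algebra S :: ((nat ^ 'd) \<Rightarrow>\<^sub>0 'k) ring"
  have span: "submonoid_add (monomial_span S :: ((nat ^ 'd) \<Rightarrow>\<^sub>0 'k) set)"
    by (rule submonoid_add_monomial_span)
  show "abelian_group ?R"
    using span uminus_in_monomial_span
    by (intro abelian_groupI) (auto simp: submonoid_add_def ac_simps intro!: bexI[of _ "- x" for x])
  have "0 \<in> S" using assms by (simp add: submonoid_add_def)
  then show "comm_monoid ?R"
    using times_in_monomial_span[of _ S _ S]
    by (intro comm_monoidI)
       (auto simp: ac_simps submonoid_add_plus_absorb[OF assms] monomial_span_def)
qed (auto simp: algebra_simps)

lemma ideal_semigroup_algebra_iff:
  fixes I :: "((nat ^ 'd) \<Rightarrow>\<^sub>0 'k::field) set"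
  assumes "submonoid_add S"
  shows "ideal I (semigroup_algebra S) \<longleftrightarrow>
    I \<subseteq> monomial_span S \<and> submonoid_add I \<and> (\<forall>r\<in>monomial_span S. \<forall>f\<in>I. r * f \<in> I)"
    (is "?L \<longleftrightarrow> ?C")
proof
  assume ?L
  then interpret ideal I "semigroup_algebra S" .
  show ?C
    using a_subset additive_subgroup.zero_closed[OF local.additive_subgroup_axioms]
      additive_subgroup.a_closed[OF local.additive_subgroup_axioms] I_l_closed
    by (auto simp: submonoid_add_def)
next
  assume C: ?C
  interpret R: cring "semigroup_algebra S :: ((nat ^ 'd) \<Rightarrow>\<^sub>0 'k) ring"
    by (rule cring_semigroup_algebra[OF assms])
  have m1: "- 1 \<in> (monomial_span S :: ((nat ^ 'd) \<Rightarrow>\<^sub>0 'k) set)"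
    using assms by (intro uminus_in_monomial_span) (auto simp: monomial_span_def submonoid_add_def)
  have neg: "- f \<in> I" if "f \<in> I" for f
    using C m1 that by (metis mult_minus1)
  have "\<ominus>\<^bsub>semigroup_algebra S\<^esub> f = - f" if "f \<in> monomial_span S" for f :: "(nat ^ 'd) \<Rightarrow>\<^sub>0 'k"
    by (rule R.minus_equality) (use that in \<open>auto simp: uminus_in_monomial_span\<close>)
  then have inv: "\<ominus>\<^bsub>semigroup_algebra S\<^esub> f \<in> I" if "f \<in> I" for f
    using that C neg by (metis subsetD)
  have comm: "f * r \<in> I" if "f \<in> I" "r \<in> monomial_span S" for f r
    using C that by (simp add: mult.commute[of f])
  show ?L
    using C inv comm by (intro idealI R.ring_axioms R.add.subgroupI) (auto simp: submonoid_add_def)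
qed

lemma ideal_prod_subsetI:
  assumes "submonoid_add P" "\<And>f g. f \<in> I \<Longrightarrow> g \<in> J \<Longrightarrow> f * g \<in> P"
  shows "I \<cdot>\<^bsub>semigroup_algebra S\<^esub> J \<subseteq> P"
proof
  fix x assume "x \<in> I \<cdot>\<^bsub>semigroup_algebra S\<^esub> J"
  then show "x \<in> P"
    by induction (use assms in \<open>auto simp: submonoid_add_def\<close>)
qed

lemma times_in_ideal_prod: "f \<in> I \<Longrightarrow> g \<in> J \<Longrightarrow> f * g \<in> I \<cdot>\<^bsub>semigroup_algebra S\<^esub> J"
  using ideal_prod.prod[of f I g J "semigroup_algebra S"] by simp

lemma ideal_monomial_span:
  assumes "submonoid_add S" "T \<subseteq> S" "S + T \<subseteq> T"
  shows "ideal (monomial_span T) (semigroup_algebra S)"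
  unfolding ideal_semigroup_algebra_iff[OF assms(1)]
  using monomial_span_mono[OF assms(2)] monomial_span_mono[OF assms(3)]
    submonoid_add_monomial_span times_in_monomial_span by blast

lemma ideal_prod_monomial_span:
  "monomial_span T \<cdot>\<^bsub>semigroup_algebra S\<^esub> monomial_span U = monomial_span (T + U)"
proof
  show "monomial_span T \<cdot>\<^bsub>semigroup_algebra S\<^esub> monomial_span U \<subseteq> monomial_span (T + U)"
    by (intro ideal_prod_subsetI submonoid_add_monomial_span times_in_monomial_span)
  let ?P = "monomial_span T \<cdot>\<^bsub>semigroup_algebra S\<^esub> monomial_span U"
  have zero: "0 \<in> ?P"
    using times_in_ideal_prod[of 0 "monomial_span T" 0 "monomial_span U" S]
      submonoid_add_monomial_span by (auto simp: submonoid_add_def)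
  show "monomial_span (T + U) \<subseteq> ?P"
  proof (rule monomial_span_subsetI)
    show "submonoid_add ?P"
      using zero ideal_prod.sum[of _ "semigroup_algebra S"] by (auto simp: submonoid_add_def)
    fix b c assume "b \<in> T + U"
    then obtain t u where "t \<in> T" "u \<in> U" "b = t + u" by (auto simp: set_plus_def)
    then show "Poly_Mapping.single b c \<in> ?P"
      using times_in_ideal_prod[of "Poly_Mapping.single t c" _ "Poly_Mapping.single u 1"]
      by (metis mult.right_neutral mult_single single_in_monomial_span)
  qed
qed

lemma genideal_monomials:
  fixes S :: "(nat ^ 'd) set"
  assumes "submonoid_add S" "B \<subseteq> S"
  shows "Idl\<^bsub>semigroup_algebra S\<^esub> (monomial ` B) =
    (monomial_span (B + S) :: ((nat ^ 'd) \<Rightarrow>\<^sub>0 'k::field) set)"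
proof
  have zero: "0 \<in> S" using assms by (simp add: submonoid_add_def)
  have "B + S \<subseteq> S"
    using submonoid_add_plus_absorb[OF assms(1)] assms(2) set_plus_mono2 by blast
  moreover have "S + (B + S) \<subseteq> B + S"
    using submonoid_add_plus_absorb[OF assms(1)] by (simp add: add.left_commute)
  ultimately have "ideal (monomial_span (B + S)) (semigroup_algebra S)"
    by (intro ideal_monomial_span assms)
  moreover have "B \<subseteq> B + S"
    using zero by (force simp: set_plus_def)
  ultimately show "Idl\<^bsub>semigroup_algebra S\<^esub> (monomial ` B) \<subseteq>
      (monomial_span (B + S) :: ((nat ^ 'd) \<Rightarrow>\<^sub>0 'k) set)"
    unfolding genideal_def by (intro Inter_lower) auto
  show "(monomial_span (B + S) :: ((nat ^ 'd) \<Rightarrow>\<^sub>0 'k) set) \<subseteq> Idl\<^bsub>semigroup_algebra S\<^esub> (monomial ` B)"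
    unfolding genideal_def
  proof (rule Inter_greatest)
    fix I :: "((nat ^ 'd) \<Rightarrow>\<^sub>0 'k) set"
    assume "I \<in> {I. ideal I (semigroup_algebra S) \<and> monomial ` B \<subseteq> I}"
    then have I: "submonoid_add I" "\<forall>r\<in>monomial_span S. \<forall>f\<in>I. r * f \<in> I" "monomial ` B \<subseteq> I"
      by (auto simp: ideal_semigroup_algebra_iff[OF assms(1)])
    show "monomial_span (B + S) \<subseteq> I"
    proof (rule monomial_span_subsetI[OF I(1)])
      fix b and c :: 'k assume "b \<in> B + S"
      then obtain t u where "t \<in> B" "u \<in> S" "b = t + u" by (auto simp: set_plus_def)
      then have "Poly_Mapping.single b c = Poly_Mapping.single u c * monomial t"
        by (simp add: monomial_def mult_single add.commute)
      then show "Poly_Mapping.single b c \<in> I"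
        using I single_in_monomial_span \<open>t \<in> B\<close> \<open>u \<in> S\<close> by (metis image_subset_iff)
    qed
  qed
qed

text \<open>
  A product of generators of the algebra is a monomial whose exponent is a sum of the generating
  exponents, so membership in \<open>K[S]\<close> can be read off from the exponents that occur.
\<close>

lemma monomial_algebra_eq_semigroup_algebra:
  "(monomial_algebra A :: ((nat ^ 'd) \<Rightarrow>\<^sub>0 'k::field) ring) = semigroup_algebra (submonoid_add hull A)"
proof -
  let ?S = "submonoid_add hull A"
  let ?P = "poly_ring :: ((nat ^ 'd) \<Rightarrow>\<^sub>0 'k) ring"
  let ?G = "generate_ring ?P (constants \<union> monomial ` A)"
  have poly_ring: "?P = semigroup_algebra UNIV"
    by (simp add: semigroup_algebra_def monomial_span_def poly_ring_def)
  interpret P: cring ?P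
    unfolding poly_ring by (rule cring_semigroup_algebra) (simp add: submonoid_add_def)
  have neg: "\<ominus>\<^bsub>?P\<^esub> f = - f" for f
    by (rule P.minus_equality) (auto simp: poly_ring_def)
  have hull: "submonoid_add ?S" by (rule submonoid_add_hull)
  then have zero: "0 \<in> ?S" by (simp add: submonoid_add_def)
  have const: "Poly_Mapping.single 0 c \<in> ?G" for c
    by (rule generate_ring.incl) (auto simp: constants_def)
  have add_closed: "f + g \<in> monomial_span ?S"
    if "f \<in> monomial_span ?S" "g \<in> monomial_span ?S" for f g :: "(nat ^ 'd) \<Rightarrow>\<^sub>0 'k"
    using that submonoid_add_monomial_span by (metis submonoid_add_def)
  have mult: "f * g \<in> ?G" if "f \<in> ?G" "g \<in> ?G" for f g
    using generate_ring.eng_mult[OF that] by (simp add: poly_ring_def)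
  have "?G = monomial_span ?S"
  proof
    show "?G \<subseteq> monomial_span ?S"
    proof
      fix f assume "f \<in> ?G"
      then show "f \<in> monomial_span ?S"
      proof induction
        case one
        then show ?case using zero by (simp add: poly_ring_def monomial_span_def)
      next
        case (incl h)
        then show ?case
          using zero hull_inc[of _ A submonoid_add]
          by (auto simp: constants_def monomial_span_def monomial_def split: if_splits)
      next
        case (a_inv h)
        then show ?case by (simp add: neg uminus_in_monomial_span)
      next
        case (eng_add f g)
        then show ?case
          using add_closed by (simp add: poly_ring_def)
      next
        case (eng_mult f g)
        then show ?case
          using times_in_monomial_span[of f ?S g ?S]
          by (simp add: poly_ring_def submonoid_add_plus_absorb[OF hull])
      qed
    qed
    have mon: "monomial b \<in> ?G" if "b \<in> ?S" for b
      using that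
    proof (rule hull_induct)
      show "monomial b \<in> ?G" if "b \<in> A" for b
        using that by (auto intro: generate_ring.incl)
      show "submonoid_add {b. monomial b \<in> ?G}"
        using const[of 1] mult by (auto simp: submonoid_add_def monomial_add) (simp add: monomial_def)
    qed
    show "monomial_span ?S \<subseteq> ?G"
    proof (rule monomial_span_subsetI)
      show "submonoid_add ?G"
        using generate_ring.eng_add[of _ ?P] const[of 0] by (auto simp: submonoid_add_def poly_ring_def)
      show "Poly_Mapping.single b c \<in> ?G" if "b \<in> ?S" for b c
        using mult[OF const[of c] mon[OF that]] by (simp add: monomial_def mult_single)
    qed
  qed
  then show ?thesis by (simp add: monomial_algebra_def semigroup_algebra_def)
qed

text \<open>
  The summand \<open>S\<close> in the base case makes the set closed under adding elements of \<open>S\<close>; that is, the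
  set consists of sums of at least \<open>n\<close> nonzero elements, the exponents of the \<open>n\<close>-th power of \<open>m\<close>.
\<close>

primrec nfold_sums :: "(nat ^ 'd) set \<Rightarrow> nat \<Rightarrow> (nat ^ 'd) set" where
  "nfold_sums S 0 = S"
| "nfold_sums S (Suc n) = (S - {0}) + nfold_sums S n"

lemma maximal_ideal_power:
  "monomial_span (S - {0}) [^]\<^bsub>ideals_set (semigroup_algebra S)\<^esub> n = monomial_span (nfold_sums S n)"
proof (induction n)
  case 0
  then show ?case by (simp add: nat_pow_def ideals_set_def)
next
  case (Suc n)
  then show ?case
    by (simp add: nat_pow_def ideals_set_def ideal_prod_monomial_span add.commute)
qed

section \<open>The cone of a simplicial semigroup\<close>

text \<open>
  On the cone this functional is positive away from the origin, so its level set at \<open>1\<close> is a compact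
  cross-section of the cone.
\<close>

definition total_degree :: "real ^ 'd \<Rightarrow> real" where
  "total_degree x = (\<Sum>i\<in>UNIV. x $ i)"

lemma linear_total_degree: "linear total_degree"
  by (rule linearI) (simp_all add: total_degree_def sum.distrib sum_distrib_left)

lemmas total_degree_add = linear_add[OF linear_total_degree]
lemmas total_degree_scaleR = linear_cmul[OF linear_total_degree, simplified]

lemma real_vec_add: "real_vec (u + v) = real_vec u + real_vec v"
  by (simp add: real_vec_def vec_eq_iff)

lemma real_vec_zero [simp]: "real_vec 0 = 0"
  by (simp add: real_vec_def vec_eq_iff)

lemma real_vec_eq_iff [simp]: "real_vec u = real_vec v \<longleftrightarrow> u = v"
  by (simp add: real_vec_def vec_eq_iff)

lemma real_vec_eq_0_iff [simp]: "real_vec u = 0 \<longleftrightarrow> u = 0"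
  using real_vec_eq_iff[of u 0] by (simp del: real_vec_eq_iff)

lemma total_degree_pos: "b \<noteq> 0 \<Longrightarrow> 0 < total_degree (real_vec b)"
  unfolding total_degree_def real_vec_def
  by (rule sum_pos2[of _ "SOME i. b $ i \<noteq> 0"]) (auto simp: vec_eq_iff intro: someI2)

lemma real_vec_hull_subset:
  assumes "convex_cone C" "real_vec ` A \<subseteq> C"
  shows "real_vec ` (submonoid_add hull A) \<subseteq> C"
proof safe
  fix b assume "b \<in> submonoid_add hull A"
  then show "real_vec b \<in> C"
    by (rule hull_induct)
       (use assms in \<open>auto simp: submonoid_add_def convex_cone_iff real_vec_add\<close>)
qed

text \<open>
  A segment of the cone meeting the ray of \<open>p\<close> projects radially to a segment of the cross-section
  through \<open>p\<close>, which must degenerate to \<open>p\<close>.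
\<close>

lemma extremal_ray_conic_hull_extreme_point:
  fixes P :: "(real ^ 'd) set"
  assumes one: "\<And>x. x \<in> P \<Longrightarrow> total_degree x = 1" and p: "p extreme_point_of P"
  shows "extremal_ray (conic hull P) (conic hull {p})"
proof -
  have pP: "p \<in> P" using p by (simp add: extreme_point_of_def)
  have "conic hull {p} face_of conic hull P"
    unfolding face_of_def
  proof (intro conjI ballI impI)
    show "conic hull {p} \<subseteq> conic hull P"
      using pP by (simp add: hull_mono)
    show "convex (conic hull {p})" by (simp add: convex_conic_hull)
    fix x y z
    assume x: "x \<in> conic hull P" and y: "y \<in> conic hull P" and z: "z \<in> conic hull {p}"
      and seg: "z \<in> open_segment x y"
    obtain a x' where x': "x = a *\<^sub>R x'" "0 \<le> a" "x' \<in> P"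
      using x by (auto simp: conic_hull_explicit)
    obtain b y' where y': "y = b *\<^sub>R y'" "0 \<le> b" "y' \<in> P"
      using y by (auto simp: conic_hull_explicit)
    obtain c where c: "z = c *\<^sub>R p" "0 \<le> c"
      using z by (auto simp: conic_hull_explicit)
    obtain u where u: "0 < u" "u < 1" "z = (1 - u) *\<^sub>R x + u *\<^sub>R y"
      using seg by (auto simp: in_segment)
    have cp: "c *\<^sub>R p = ((1 - u) * a) *\<^sub>R x' + (u * b) *\<^sub>R y'"
      using u c x' y' by simp
    \<comment> \<open>Comparing degrees identifies the weights of the radially projected points.\<close>
    have deg: "c = (1 - u) * a + u * b"
      using arg_cong[OF cp, of total_degree] one pP x' y'
      by (simp add: total_degree_add total_degree_scaleR)
    have ray: "t *\<^sub>R p \<in> conic hull {p}" if "0 \<le> t" for t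
      using that by (auto simp: conic_hull_explicit)
    have zero: "0 \<in> conic hull {p}" using ray[of 0] by simp
    have "(a = 0 \<or> x' = p) \<and> (b = 0 \<or> y' = p)"
    proof (cases "a = 0 \<or> b = 0")
      case True
      then show ?thesis
        using cp deg u by (auto simp: scaleR_left_imp_eq)
    next
      case False
      then have pos: "0 < (1 - u) * a" "0 < u * b" using u x' y' by auto
      then have "0 < c" using deg by simp
      define w where "w = u * b / c"
      have w: "0 < w" "w < 1" "1 - w = (1 - u) * a / c"
        using pos \<open>0 < c\<close> deg by (auto simp: w_def field_simps)
      have "p = (1 / c) *\<^sub>R (c *\<^sub>R p)" using \<open>0 < c\<close> by simp
      also have "\<dots> = (1 - w) *\<^sub>R x' + w *\<^sub>R y'"
        unfolding cp w(3) by (simp add: w_def scaleR_add_right)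
      finally have peq: "p = (1 - w) *\<^sub>R x' + w *\<^sub>R y'" .
      have "x' = y'"
        using p x' y' w peq unfolding extreme_point_of_def in_segment by blast
      then have "x' = p" using peq by (simp add: algebra_simps)
      then show ?thesis using \<open>x' = y'\<close> by simp
    qed
    then show "x \<in> conic hull {p}" "y \<in> conic hull {p}"
      using x' y' ray zero by auto
  qed
  moreover have "p \<noteq> 0" using one[OF pP] by (auto simp: total_degree_def)
  ultimately show ?thesis unfolding extremal_ray_def by blast
qed

text \<open>
  Two lattice points on a ray of the non-negative orthant differ by a positive scalar, so the one of
  smaller degree is componentwise smaller, and a point of least degree is the generator of the ray.
\<close>

lemma ex_extremal_ray_generator:
  assumes F: "extremal_ray (semigroup_cone S) F" and b: "b \<in> S" "b \<noteq> 0" "real_vec b \<in> F"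
  shows "\<exists>c\<in>extremal_ray_generators S. real_vec c \<in> F"
proof -
  let ?X = "{c \<in> S. c \<noteq> 0 \<and> real_vec c \<in> F}"
  let ?deg = "\<lambda>c :: nat ^ 'a. \<Sum>i\<in>UNIV. c $ i"
  obtain v where v: "v \<noteq> 0" "F = conic hull {v}"
    using F by (auto simp: extremal_ray_def)
  obtain c where c: "c \<in> ?X" and min: "\<And>x. x \<in> ?X \<Longrightarrow> ?deg c \<le> ?deg x"
    using b ex_has_least_nat[of "\<lambda>c. c \<in> ?X" b ?deg] by auto
  have "c \<le> x" if x: "x \<in> ?X" for x
  proof -
    obtain s where s: "real_vec c = s *\<^sub>R v" "0 \<le> s"
      using c v by (auto simp: conic_hull_explicit)
    obtain t where t: "real_vec x = t *\<^sub>R v" "0 \<le> t"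
      using x v by (auto simp: conic_hull_explicit)
    have "s > 0" using s c by (cases "s = 0") (auto simp del: real_vec_eq_iff)
    have deg: "total_degree (real_vec y) = real (?deg y)" for y :: "nat ^ 'a"
      by (simp add: total_degree_def real_vec_def)
    have "0 < s * total_degree v"
      using total_degree_pos[of c] c s by (simp add: total_degree_scaleR)
    then have "0 < total_degree v" using \<open>s > 0\<close> by (simp add: zero_less_mult_iff)
    moreover have "s * total_degree v \<le> t * total_degree v"
      using min[OF x] deg[of c] deg[of x] s t
      by (simp add: total_degree_scaleR flip: of_nat_sum)
    ultimately have "s \<le> t" by simp
    have "real (c $ i) \<le> real (x $ i)" for i
    proof -
      have ci: "real (c $ i) = s * v $ i" and xi: "real (x $ i) = t * v $ i"
        using arg_cong[OF s(1), of "\<lambda>w. w $ i"] arg_cong[OF t(1), of "\<lambda>w. w $ i"]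
        by (simp_all add: real_vec_def)
      have "0 \<le> v $ i" using ci \<open>s > 0\<close> by (metis of_nat_0_le_iff zero_le_mult_iff not_less)
      then show ?thesis using ci xi \<open>s \<le> t\<close> by (simp add: mult_right_mono)
    qed
    then show ?thesis by (simp add: less_eq_vec_def)
  qed
  then show ?thesis
    using c F by (intro bexI[of _ c]) (auto simp: extremal_ray_generators_def)
qed

text \<open>
  The normalised generators span a polytope \<open>P\<close>, a cross-section of the cone. By the theorem of Krein
  and Milman it is the convex hull of its extreme points, and each of these lies on an extremal ray,
  hence is a multiple of the generator of that ray.
\<close>

lemma real_vec_in_cone_of_extremal_ray_generators:
  assumes A: "finite A" "0 \<notin> A" "S = submonoid_add hull A" and "b \<in> S"
  shows "real_vec b \<in> convex_cone hull (real_vec ` extremal_ray_generators S)"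
proof -
  let ?G = "extremal_ray_generators S"
  let ?C = "convex_cone hull (real_vec ` ?G)"
  define normal :: "nat ^ 'a \<Rightarrow> real ^ 'a" where
    "normal a = (1 / total_degree (real_vec a)) *\<^sub>R real_vec a" for a
  have AS: "A \<subseteq> S" using A by (simp add: hull_subset)
  have real_vec_normal: "real_vec a = total_degree (real_vec a) *\<^sub>R normal a"
    and normal_deg: "total_degree (normal a) = 1"
    if "a \<in> A" for a
  proof -
    have "0 < total_degree (real_vec a)" using that A(2) by (metis total_degree_pos)
    then show "real_vec a = total_degree (real_vec a) *\<^sub>R normal a" "total_degree (normal a) = 1"
      by (simp_all add: normal_def total_degree_scaleR)
  qed
  define P where "P = convex hull (normal ` A)"
  have P_deg: "total_degree x = 1" if "x \<in> P" for x
  proof -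
    have "convex {x :: real ^ 'a. total_degree x = 1}"
      by (auto simp: convex_def total_degree_add total_degree_scaleR)
    then have "P \<subseteq> {x. total_degree x = 1}"
      unfolding P_def by (rule hull_minimal[rotated]) (auto simp: normal_deg)
    then show ?thesis using that by blast
  qed
  show ?thesis
  proof (cases "A = {}")
    case True
    have "submonoid_add hull {} \<subseteq> {0 :: nat ^ 'a}"
      by (rule hull_minimal) (auto simp: submonoid_add_def)
    then have "b = 0" using \<open>b \<in> S\<close> A True by auto
    then show ?thesis by (simp add: convex_cone_hull_contains_0)
  next
    case False
    have cone: "semigroup_cone S = conic hull P"
    proof -
      have "convex_cone (conic hull P)"
        using False by (simp add: P_def convex_cone_def convex_conic_hull conic_conic_hull conic_hull_eq_empty)
      moreover have "real_vec ` A \<subseteq> conic hull P"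
        using real_vec_normal total_degree_pos A hull_inc[of _ "normal ` A" convex]
        unfolding P_def conic_hull_explicit by (force intro: less_imp_le)
      ultimately have 1: "semigroup_cone S \<subseteq> conic hull P"
        unfolding semigroup_cone_def A(3) by (intro hull_minimal real_vec_hull_subset)
      have cc: "convex_cone (semigroup_cone S)"
        by (simp add: semigroup_cone_def convex_cone_convex_cone_hull)
      have "real_vec ` A \<subseteq> semigroup_cone S"
        unfolding semigroup_cone_def using AS by (meson hull_subset image_mono order_trans)
      then have "normal ` A \<subseteq> semigroup_cone S"
        by (auto simp: normal_def total_degree_def real_vec_def
            intro!: convex_cone_scaleR[OF cc] sum_nonneg)
      then have "P \<subseteq> semigroup_cone S"
        unfolding P_def using cc by (intro hull_minimal) (auto simp: convex_cone_def)
      then have 2: "conic hull P \<subseteq> semigroup_cone S"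
        using cc by (intro hull_minimal) (auto simp: convex_cone_def)
      show ?thesis using 1 2 by blast
    qed
    have extreme: "p \<in> ?C" if p: "p extreme_point_of P" for p
    proof -
      obtain a where a: "a \<in> A" "p = normal a"
        using extreme_point_of_convex_hull[OF p[unfolded P_def]] by blast
      have ray: "extremal_ray (semigroup_cone S) (conic hull {p})"
        unfolding cone using extremal_ray_conic_hull_extreme_point[OF P_deg p] by blast
      have "0 \<le> total_degree (real_vec a)"
        by (simp add: total_degree_def real_vec_def sum_nonneg)
      then have "real_vec a \<in> conic hull {p}"
        using real_vec_normal[OF a(1)] a(2) unfolding conic_hull_explicit by blast
      then obtain c where c: "c \<in> ?G" "real_vec c \<in> conic hull {p}"
        using ex_extremal_ray_generator[OF ray, of a] a A AS by blast
      then obtain t where t: "real_vec c = t *\<^sub>R p" "0 \<le> t"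
        by (auto simp: conic_hull_explicit)
      moreover have "c \<noteq> 0" using c by (simp add: extremal_ray_generators_def)
      ultimately have "0 < t" by (cases "t = 0") (auto simp del: real_vec_eq_iff)
      then have "p = (1 / t) *\<^sub>R real_vec c" using t by simp
      moreover have "real_vec c \<in> ?C" using c by (simp add: hull_inc)
      ultimately show ?thesis using \<open>0 < t\<close> by (simp add: convex_cone_hull_mul)
    qed
    have "P = convex hull {p. p extreme_point_of P}"
      unfolding P_def using A(1)
      by (intro Krein_Milman_Minkowski finite_imp_compact_convex_hull convex_convex_hull) auto
    also have "\<dots> \<subseteq> ?C"
      using extreme by (intro hull_minimal) (auto simp: convex_convex_cone_hull)
    finally have "P \<subseteq> ?C" .
    then have "conic hull P \<subseteq> ?C"
      by (intro hull_minimal) (auto simp: conic_convex_cone_hull)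
    moreover have "real_vec b \<in> semigroup_cone S"
      using \<open>b \<in> S\<close> by (simp add: semigroup_cone_def hull_inc)
    ultimately show ?thesis using cone by blast
  qed
qed

lemma convex_cone_hull_range_subset:
  fixes f :: "'i::finite \<Rightarrow> 'a::real_vector"
  shows "convex_cone hull (range f) \<subseteq> {\<Sum>i\<in>UNIV. c i *\<^sub>R f i | c. \<forall>i. 0 \<le> c i}" (is "_ \<subseteq> ?N")
proof (rule hull_minimal)
  show "range f \<subseteq> ?N"
  proof safe
    fix i
    show "\<exists>c. f i = (\<Sum>j\<in>UNIV. c j *\<^sub>R f j) \<and> (\<forall>j. 0 \<le> c j)"
      by (rule exI[of _ "\<lambda>j. if j = i then 1 else 0"]) (simp add: if_distrib[of "\<lambda>t. t *\<^sub>R _"] cong: if_cong)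
  qed
  have N: "(\<Sum>i\<in>UNIV. c i *\<^sub>R f i) \<in> ?N" if "\<And>i. 0 \<le> c i" for c
    using that by blast
  show "convex_cone ?N"
    unfolding convex_cone_iff
  proof (intro conjI ballI allI impI)
    show "0 \<in> ?N" using N[of "\<lambda>_. 0"] by simp
    fix x assume "x \<in> ?N"
    then obtain c where c: "x = (\<Sum>i\<in>UNIV. c i *\<^sub>R f i)" "\<And>i. 0 \<le> c i" by blast
    show "t *\<^sub>R x \<in> ?N" if "0 \<le> t" for t
      using N[of "\<lambda>i. t * c i"] c that by (simp add: scaleR_sum_right)
    fix y assume "y \<in> ?N"
    then obtain d where d: "y = (\<Sum>i\<in>UNIV. d i *\<^sub>R f i)" "\<And>i. 0 \<le> d i" by blast
    show "x + y \<in> ?N"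
      using N[of "\<lambda>i. c i + d i"] c d by (simp add: scaleR_add_left sum.distrib)
  qed
qed

lemma det_in_Ints:
  fixes M :: "real ^ 'n ^ 'n"
  assumes "\<And>i j. M $ i $ j \<in> \<int>"
  shows "det M \<in> \<int>"
  unfolding det_def using assms by (intro Ints_sum Ints_mult Ints_prod Ints_of_int) auto

text \<open>
  The matrix \<open>X\<close> with columns \<open>\<alpha> i\<close> is invertible because its columns span the space. With
  \<open>M = \<bar>det X\<bar>\<close>, Cramer's rule makes \<open>M\<close> times the coordinates of a lattice point integral, and
  the coordinates are non-negative on the cone.
\<close>

lemma simplicial_coordinates:
  fixes S :: "(nat ^ 'd) set" and \<alpha> :: "'d \<Rightarrow> nat ^ 'd"
  assumes A: "finite A" "0 \<notin> A" "S = submonoid_add hull A"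
    and full: "fully_embedded S" and \<alpha>: "range \<alpha> = extremal_ray_generators S"
  obtains M :: nat and q :: "nat ^ 'd \<Rightarrow> 'd \<Rightarrow> nat" where
    "0 < M"
    "\<And>u v i. u \<in> S \<Longrightarrow> v \<in> S \<Longrightarrow> q (u + v) i = q u i + q v i"
    "\<And>i j. q (\<alpha> i) j = (if i = j then M else 0)"
    "\<And>b. b \<in> S \<Longrightarrow> M *s b = (\<Sum>i\<in>UNIV. q b i *s \<alpha> i)"
proof -
  define X :: "real ^ 'd ^ 'd" where "X = (\<chi> r i. real (\<alpha> i $ r))"
  have col: "column i X = real_vec (\<alpha> i)" for i
    by (simp add: X_def column_def real_vec_def)
  have sumX: "X *v x = (\<Sum>i\<in>UNIV. x $ i *\<^sub>R real_vec (\<alpha> i))" for x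
    by (simp add: matrix_mult_sum col scalar_mult_eq_scaleR)
  have \<alpha>S: "\<alpha> i \<in> S" for i
    using \<alpha> by (auto simp: extremal_ray_generators_def)
  have nonneg: "\<exists>x. real_vec b = X *v x \<and> (\<forall>i. 0 \<le> x $ i)" if "b \<in> S" for b
  proof -
    have "real_vec b \<in> convex_cone hull (range (\<lambda>i. real_vec (\<alpha> i)))"
      using real_vec_in_cone_of_extremal_ray_generators[OF A that]
      unfolding \<alpha>[symmetric] by (simp add: image_image)
    then obtain c where "real_vec b = (\<Sum>i\<in>UNIV. c i *\<^sub>R real_vec (\<alpha> i))" "\<forall>i. 0 \<le> c i"
      using convex_cone_hull_range_subset by blast
    then show ?thesis by (intro exI[of _ "\<chi> i. c i"]) (simp add: sumX)
  qed
  have "real_vec ` S \<subseteq> range ((*v) X)"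
    using nonneg by blast
  then have "span (real_vec ` S) \<subseteq> range ((*v) X)"
    by (rule span_minimal) (simp add: linear_subspace_image)
  then have "surj ((*v) X)"
    using full by (auto simp: fully_embedded_def)
  then have "\<exists>B. X ** B = mat 1"
    by (simp add: matrix_right_invertible_surjective)
  then have "invertible X"
    by (metis invertible_def matrix_left_right_inverse)
  then have det: "det X \<noteq> 0" by (simp add: invertible_det_nz)
  have XInt: "X $ i $ j \<in> \<int>" for i j by (simp add: X_def)
  have inj: "x = y" if "X *v x = X *v y" for x y
    using cramer[OF det, of x "X *v y"] cramer[OF det, of y "X *v y"] that by simp
  define M where "M = nat \<bar>\<lfloor>det X\<rfloor>\<bar>"
  have M: "real M = \<bar>det X\<bar>"
    using det_in_Ints[OF XInt] by (auto simp: M_def elim!: Ints_cases)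
  define coord where "coord b = (THE x. X *v x = real_vec b)" for b
  have coord_eqI: "coord b = x" if "X *v x = real_vec b" for b x
    unfolding coord_def using that inj by (intro the_equality) auto
  have coord: "X *v coord b = real_vec b \<and> (\<forall>i. 0 \<le> coord b $ i)" if "b \<in> S" for b
    using nonneg[OF that] coord_eqI by metis
  have coord_Ints: "real M * coord b $ i \<in> \<int>" if "b \<in> S" for b i
  proof -
    have "coord b = (\<chi> k. det (\<chi> i j. if j = k then real_vec b $ i else X $ i $ j) / det X)"
      using coord[OF that] cramer[OF det] by blast
    then have "det X * coord b $ i = det (\<chi> r j. if j = i then real_vec b $ r else X $ r $ j)"
      using det by simp
    also have "\<dots> \<in> \<int>"
      by (rule det_in_Ints) (simp add: XInt real_vec_def)
    finally have "det X * coord b $ i \<in> \<int>" .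
    then have "\<bar>det X * coord b $ i\<bar> \<in> \<int>" by (rule Ints_abs)
    then show ?thesis using coord[OF that] by (simp add: M abs_mult)
  qed
  define q where "q b i = nat \<lfloor>real M * coord b $ i\<rfloor>" for b i
  have q: "real (q b i) = real M * coord b $ i" if "b \<in> S" for b i
  proof -
    have "0 \<le> real M * coord b $ i" using coord[OF that] by simp
    then show ?thesis using coord_Ints[OF that, of i] unfolding q_def by (auto elim!: Ints_cases)
  qed
  have closed: "u + v \<in> S" if "u \<in> S" "v \<in> S" for u v
    using that submonoid_add_hull[of A] unfolding A(3) submonoid_add_def by blast
  show ?thesis
  proof (rule that)
    show "0 < M" using M det by simp
    fix u v i assume uv: "u \<in> S" "v \<in> S"
    have "coord (u + v) = coord u + coord v"
      using coord[OF uv(1)] coord[OF uv(2)]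
      by (intro coord_eqI) (simp add: matrix_vector_right_distrib real_vec_add)
    then have "real (q (u + v) i) = real (q u i + q v i)"
      by (simp add: q uv closed distrib_left)
    then show "q (u + v) i = q u i + q v i" by (simp only: of_nat_eq_iff)
  next
    fix i j
    have "coord (\<alpha> i) = axis i 1"
      by (rule coord_eqI) (simp add: matrix_vector_mult_basis col)
    then have "real (q (\<alpha> i) j) = real (if i = j then M else 0)"
      by (simp add: q \<alpha>S axis_def)
    then show "q (\<alpha> i) j = (if i = j then M else 0)" by (simp only: of_nat_eq_iff)
  next
    fix b assume b: "b \<in> S"
    have "real ((M *s b) $ r) = real ((\<Sum>i\<in>UNIV. q b i *s \<alpha> i) $ r)" for r
    proof -
      have "real (b $ r) = (\<Sum>i\<in>UNIV. coord b $ i * real (\<alpha> i $ r))"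
        using arg_cong[OF conjunct1[OF coord[OF b]], of "\<lambda>w. w $ r"]
        by (simp add: sumX real_vec_def)
      then show ?thesis
        by (simp add: q[OF b] sum_distrib_left mult.assoc)
    qed
    then show "M *s b = (\<Sum>i\<in>UNIV. q b i *s \<alpha> i)"
      unfolding vec_eq_iff of_nat_eq_iff by blast
  qed
qed

section \<open>Sums of nonzero elements and powers of the maximal ideal\<close>

lemma add_eq_0_iff_nat_vec [simp]: "u + v = 0 \<longleftrightarrow> u = 0 \<and> v = (0 :: nat ^ 'd)"
  by (auto simp: vec_eq_iff)

lemma Suc_smult_nat_vec: "Suc k *s u = u + k *s u"
  by (simp add: vec_eq_iff)

context
  fixes S :: "(nat ^ 'd) set"
  assumes S: "submonoid_add S"
begin

lemma nfold_sums_absorb: "S + nfold_sums S n = nfold_sums S n"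
proof (induction n)
  case 0
  then show ?case by (simp add: submonoid_add_plus_absorb[OF S])
next
  case (Suc n)
  then show ?case by (simp add: add.left_commute[of S])
qed

lemma nfold_sums_subset: "nfold_sums S n \<subseteq> S"
proof (induction n)
  case (Suc n)
  then have "(S - {0}) + nfold_sums S n \<subseteq> S + S" by (intro set_plus_mono2) auto
  then show ?case by (simp add: submonoid_add_plus_absorb[OF S])
qed simp

lemma nfold_sums_Suc_subset: "nfold_sums S (Suc n) \<subseteq> nfold_sums S n"
  using set_plus_mono2[of "S - {0}" S "nfold_sums S n" "nfold_sums S n"]
  by (simp add: nfold_sums_absorb)

lemma nfold_sums_antimono: "m \<le> n \<Longrightarrow> nfold_sums S n \<subseteq> nfold_sums S m"
  by (rule lift_Suc_antimono_le[of "nfold_sums S"]) (use nfold_sums_Suc_subset in auto)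

lemma nfold_sums_add: "nfold_sums S m + nfold_sums S n = nfold_sums S (m + n)"
  by (induction m) (simp_all add: nfold_sums_absorb add.assoc)

lemma add_in_nfold_sums:
  "u \<in> nfold_sums S m \<Longrightarrow> v \<in> nfold_sums S n \<Longrightarrow> u + v \<in> nfold_sums S (m + n)"
  using nfold_sums_add by (metis set_plus_intro)

lemma smult_in_nfold_sums:
  assumes "u \<in> S" "u \<noteq> 0"
  shows "k *s u \<in> nfold_sums S k"
proof (induction k)
  case 0
  then show ?case using S by (simp add: submonoid_add_def)
next
  case (Suc k)
  then show ?case using assms by (auto simp: Suc_smult_nat_vec set_plus_def)
qed

lemma in_nfold_sums_1: "u \<in> S \<Longrightarrow> u \<noteq> 0 \<Longrightarrow> u \<in> nfold_sums S 1"
  using S by (force simp: set_plus_def submonoid_add_def)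

lemma monomial_span_subset_ideal:
  fixes I :: "((nat ^ 'd) \<Rightarrow>\<^sub>0 'k::field) set"
  assumes "ideal I (semigroup_algebra S)" "\<And>b. b \<in> T \<Longrightarrow> monomial b \<in> I"
  shows "monomial_span T \<subseteq> I"
proof (rule monomial_span_subsetI)
  have I: "submonoid_add I" "\<And>r f. r \<in> monomial_span S \<Longrightarrow> f \<in> I \<Longrightarrow> r * f \<in> I"
    using assms(1) by (auto simp: ideal_semigroup_algebra_iff[OF S])
  show "submonoid_add I" by (rule I)
  fix b and c :: 'k assume "b \<in> T"
  have "Poly_Mapping.single 0 c \<in> monomial_span S"
    using S by (auto simp: submonoid_add_def intro: single_in_monomial_span)
  then have "Poly_Mapping.single 0 c * monomial b \<in> I"
    using I(2) assms(2)[OF \<open>b \<in> T\<close>] by blast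
  then show "Poly_Mapping.single b c \<in> I" by (simp add: monomial_def mult_single)
qed

text \<open>
  An exponent \<open>c\<close> outside \<open>(S - {0}) + T\<close> arises in a product only by multiplying \<open>x^c\<close> with a
  constant. Hence a linear condition on the coefficients at such exponents cuts out an ideal.
\<close>

lemma coeff_times_indecomposable:
  assumes "c \<notin> (S - {0}) + T" "r \<in> monomial_span S" "f \<in> monomial_span T"
  shows "coeff (r * f) c = coeff r 0 * coeff f c"
proof -
  let ?r0 = "Poly_Mapping.single 0 (coeff r 0)"
  have "r - ?r0 \<in> monomial_span (S - {0})"
    using assms(2) by (auto simp: in_monomial_span_iff lookup_minus lookup_single when_def)
  then have "(r - ?r0) * f \<in> monomial_span ((S - {0}) + T)"
    using assms(3) by (rule times_in_monomial_span)
  then have "coeff ((r - ?r0) * f) c = 0"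
    using assms(1) by (auto simp: in_monomial_span_iff)
  moreover have "coeff (?r0 * f) c = coeff r 0 * coeff f c"
    unfolding mult_map_scale_conv_mult[symmetric] by (simp add: map.rep_eq when_def)
  ultimately show ?thesis by (simp add: left_diff_distrib lookup_minus)
qed

lemma reduction_ideal_semigroup_algebra_iff:
  "reduction_ideal (semigroup_algebra S) (monomial_span (S - {0})) J \<longleftrightarrow>
    ideal J (semigroup_algebra S) \<and> J \<subseteq> monomial_span (S - {0}) \<and>
    (\<forall>\<^sub>F n in sequentially. monomial_span (nfold_sums S (Suc n)) =
       J \<cdot>\<^bsub>semigroup_algebra S\<^esub> monomial_span (nfold_sums S n))"
  unfolding reduction_ideal_def maximal_ideal_power by simp

lemma reduction_ideal_monomial_spanD:
  assumes "reduction_ideal (semigroup_algebra S) (monomial_span (S - {0}))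
      (monomial_span T :: ((nat ^ 'd) \<Rightarrow>\<^sub>0 'k::field) set)"
  shows "\<exists>n0. \<forall>n\<ge>n0. nfold_sums S (Suc n) = T + nfold_sums S n"
proof -
  have "monomial_span T = (monomial_span U :: ((nat ^ 'd) \<Rightarrow>\<^sub>0 'k) set) \<longleftrightarrow> T = U" for T U
    by (simp add: set_eq_subset monomial_span_subset_iff)
  then show ?thesis
    using assms
    by (simp add: reduction_ideal_semigroup_algebra_iff ideal_prod_monomial_span eventually_sequentially)
qed

end

section \<open>Coordinates with respect to the extremal generators\<close>

text \<open>
  This is all that the algebraic arguments use about the cone. The coordinates \<open>q\<close> are scaled by \<open>M\<close>
  to stay within the natural numbers.
\<close>

locale ray_coordinates =
  fixes S :: "(nat ^ 'd) set" and \<alpha> :: "'d \<Rightarrow> nat ^ 'd" and M :: nat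
    and q :: "nat ^ 'd \<Rightarrow> 'd \<Rightarrow> nat"
  assumes submonoid: "submonoid_add S"
    and ray_in: "\<alpha> i \<in> S"
    and M_pos: "0 < M"
    and q_add: "u \<in> S \<Longrightarrow> v \<in> S \<Longrightarrow> q (u + v) i = q u i + q v i"
    and q_ray: "q (\<alpha> i) j = (if i = j then M else 0)"
    and q_expand: "b \<in> S \<Longrightarrow> M *s b = (\<Sum>i\<in>UNIV. q b i *s \<alpha> i)"
    and ray_least: "u \<in> S \<Longrightarrow> u \<noteq> 0 \<Longrightarrow> (\<And>j. j \<noteq> i \<Longrightarrow> q u j = 0) \<Longrightarrow> \<alpha> i \<le> u"
begin

definition weight :: "nat ^ 'd \<Rightarrow> nat" where
  "weight b = (\<Sum>i\<in>UNIV. q b i)"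

lemma zero_in: "0 \<in> S"
  using submonoid by (simp add: submonoid_add_def)

lemma add_in: "u \<in> S \<Longrightarrow> v \<in> S \<Longrightarrow> u + v \<in> S"
  using submonoid by (simp add: submonoid_add_def)

lemma q_zero: "q 0 i = 0"
  using q_add[OF zero_in zero_in, of i] by simp

lemma ray_nonzero: "\<alpha> i \<noteq> 0"
  using q_ray[of i i] q_zero M_pos by (metis less_irrefl)

lemma inj_ray: "\<alpha> i = \<alpha> j \<longleftrightarrow> i = j"
  using q_ray[of i i] q_ray[of j i] M_pos by (auto split: if_splits)

lemma weight_add: "u \<in> S \<Longrightarrow> v \<in> S \<Longrightarrow> weight (u + v) = weight u + weight v"
  by (simp add: weight_def q_add sum.distrib)

lemma weight_ray: "weight (\<alpha> i) = M"
  by (simp add: weight_def q_ray)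

lemma weight_smult: "u \<in> S \<Longrightarrow> weight (k *s u) = k * weight u"
proof (induction k)
  case 0
  then show ?case by (simp add: weight_def q_zero)
next
  case (Suc k)
  have "k *s u \<in> S"
    using Suc.prems zero_in smult_in_nfold_sums[OF submonoid, of u k] nfold_sums_subset[OF submonoid]
    by (cases "u = 0") auto
  then show ?case using Suc by (simp add: Suc_smult_nat_vec weight_add)
qed

text \<open>
  Coordinates are additive and non-negative, so all summands of an element of a ray lie on that ray,
  where \<open>\<alpha> i\<close> is the least nonzero element.
\<close>

lemma smult_ray_le:
  "u \<in> nfold_sums S n \<Longrightarrow> (\<And>j. j \<noteq> i \<Longrightarrow> q u j = 0) \<Longrightarrow> n *s \<alpha> i \<le> u"
proof (induction n arbitrary: u)
  case 0
  then show ?case by (simp add: less_eq_vec_def)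
next
  case (Suc n)
  then obtain x v where xv: "x \<in> S" "x \<noteq> 0" "v \<in> nfold_sums S n" "u = x + v"
    by (auto simp: set_plus_def)
  then have v: "v \<in> S" using nfold_sums_subset[OF submonoid] by blast
  have "q x j = 0" "q v j = 0" if "j \<noteq> i" for j
    using Suc.prems(2)[OF that] xv v by (auto simp: q_add)
  then have "\<alpha> i \<le> x" "n *s \<alpha> i \<le> v"
    using ray_least xv Suc.IH by auto
  then show ?case using xv by (auto simp: less_eq_vec_def intro: add_mono)
qed

lemma ray_irreducible:
  assumes "\<alpha> i = u + v" "u \<in> S" "v \<in> S"
  shows "u = 0 \<or> v = 0"
proof (rule ccontr)
  assume nz: "\<not> ?thesis"
  have "u + v \<in> nfold_sums S 2"
    using nz assms add_in_nfold_sums[OF submonoid, of u 1 v 1] in_nfold_sums_1[OF submonoid]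
    by (simp add: numeral_2_eq_2)
  then have "2 *s \<alpha> i \<le> \<alpha> i"
    using smult_ray_le[of "\<alpha> i" 2 i] q_ray unfolding assms(1)[symmetric] by simp
  then have "\<alpha> i = 0" by (auto simp: less_eq_vec_def vec_eq_iff)
  then show False using ray_nonzero by blast
qed

lemma sum_rays_in_nfold_sums: "(\<Sum>i\<in>I. m i *s \<alpha> i) \<in> nfold_sums S (\<Sum>i\<in>I. m i)"
proof (induction I rule: infinite_finite_induct)
  case (insert i I)
  then show ?case
    using add_in_nfold_sums[OF submonoid] smult_in_nfold_sums[OF submonoid ray_in ray_nonzero] by simp
qed (simp_all add: zero_in)

lemma sum_rays_peel:
  assumes "0 < m i"
  shows "(\<Sum>j\<in>UNIV. m j *s \<alpha> j) = \<alpha> i + (\<Sum>j\<in>UNIV. (m(i := m i - 1)) j *s \<alpha> j)"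
    and "(\<Sum>j\<in>UNIV. m j) = Suc (\<Sum>j\<in>UNIV. (m(i := m i - 1)) j)"
proof -
  have "m i *s \<alpha> i = \<alpha> i + (m i - 1) *s \<alpha> i"
    using assms Suc_smult_nat_vec[of "m i - 1" "\<alpha> i"] by simp
  moreover have "(\<Sum>j\<in>UNIV - {i}. m j *s \<alpha> j) = (\<Sum>j\<in>UNIV - {i}. (m(i := m i - 1)) j *s \<alpha> j)"
    by (rule sum.cong) auto
  moreover have "(\<Sum>j\<in>UNIV. m j *s \<alpha> j) = m i *s \<alpha> i + (\<Sum>j\<in>UNIV - {i}. m j *s \<alpha> j)"
    "(\<Sum>j\<in>UNIV. (m(i := m i - 1)) j *s \<alpha> j) =
      (m i - 1) *s \<alpha> i + (\<Sum>j\<in>UNIV - {i}. (m(i := m i - 1)) j *s \<alpha> j)"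
    by (simp_all add: sum.remove[of UNIV i])
  ultimately show "(\<Sum>j\<in>UNIV. m j *s \<alpha> j) = \<alpha> i + (\<Sum>j\<in>UNIV. (m(i := m i - 1)) j *s \<alpha> j)"
    by (simp only: add.assoc)
  have "sum m (UNIV - {i}) = sum (m(i := m i - 1)) (UNIV - {i})"
    by (rule sum.cong) auto
  moreover have "sum m UNIV = m i + sum m (UNIV - {i})"
    "sum (m(i := m i - 1)) UNIV = (m i - 1) + sum (m(i := m i - 1)) (UNIV - {i})"
    by (simp_all add: sum.remove[of UNIV i])
  ultimately show "(\<Sum>j\<in>UNIV. m j) = Suc (\<Sum>j\<in>UNIV. (m(i := m i - 1)) j)"
    using assms by linarith
qed

end

section \<open>Minimality of the ideal of the extremal generators\<close>

text \<open>
  The functional is the coordinate \<open>j\<close> of an endomorphism that vanishes on a basis of \<open>V\<close> and fixes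
  some \<open>x\<close> outside \<open>V\<close> with \<open>x $ j \<noteq> 0\<close>.
\<close>

lemma proper_subspace_annihilator:
  fixes V :: "('k::field ^ 'd) set"
  assumes "vec.subspace V" "V \<noteq> UNIV"
  obtains c :: "'d \<Rightarrow> 'k" where "\<exists>i. c i \<noteq> 0" "\<And>v. v \<in> V \<Longrightarrow> (\<Sum>i\<in>UNIV. c i * v $ i) = 0"
proof -
  obtain x where x: "x \<notin> V" using assms(2) by blast
  obtain B where B: "B \<subseteq> V" "vec.independent B" "V \<subseteq> vec.span B"
    by (rule vec.basis_exists)
  have "vec.span B \<subseteq> V" using B(1) assms(1) by (rule vec.span_minimal)
  then have "x \<notin> vec.span B" using x by blast
  then have "vec.independent (insert x B)" using B(2) by (rule vec.independent_insertI)
  then obtain g :: "'k ^ 'd \<Rightarrow> 'k ^ 'd" where g: "Vector_Spaces.linear (*s) (*s) g"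
      and gx: "\<And>y. y \<in> insert x B \<Longrightarrow> g y = (if y = x then x else 0)"
    using vec.linear_independent_extend[of "insert x B" "\<lambda>y. if y = x then x else 0"] by blast
  have "x \<noteq> 0" using x vec.subspace_0[OF assms(1)] by blast
  then obtain j where j: "x $ j \<noteq> 0" by (auto simp: vec_eq_iff)
  define c where "c i = matrix g $ j $ i" for i
  have c: "g v $ j = (\<Sum>i\<in>UNIV. c i * v $ i)" for v
    using arg_cong[OF matrix_works[OF g, of v], of "\<lambda>w. w $ j"]
    by (simp add: c_def matrix_vector_mult_def)
  have "g v = 0" if "v \<in> V" for v
  proof (rule vec.linear_eq_0_on_span[OF g])
    show "v \<in> vec.span B" using that B(3) by blast
    show "g y = 0" if "y \<in> B" for y
      using gx[of y] that B(1) x by auto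
  qed
  then have "(\<Sum>i\<in>UNIV. c i * v $ i) = 0" if "v \<in> V" for v
    using c[of v] that by simp
  moreover have "\<exists>i. c i \<noteq> 0"
  proof (rule ccontr)
    assume "\<not> ?thesis"
    then show False using c[of x] gx[of x] j by simp
  qed
  ultimately show ?thesis using that by blast
qed

definition linear_extension :: "('a \<Rightarrow> 'k) \<Rightarrow> ('a \<Rightarrow>\<^sub>0 'k::field) \<Rightarrow> 'k" where
  "linear_extension \<psi> g = (\<Sum>b\<in>Poly_Mapping.keys g. coeff g b * \<psi> b)"

lemma linear_extension_add:
  "linear_extension \<psi> (f + g) = linear_extension \<psi> f + linear_extension \<psi> g"
  unfolding linear_extension_def by (rule setsum_keys_plus_distrib) (simp_all add: distrib_right)

lemma linear_extension_zero [simp]: "linear_extension \<psi> 0 = 0"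
  by (simp add: linear_extension_def)

lemma linear_extension_single [simp]: "linear_extension \<psi> (Poly_Mapping.single b c) = c * \<psi> b"
  by (simp add: linear_extension_def)

lemma linear_extension_sum:
  "linear_extension \<psi> (\<Sum>i\<in>I. f i) = (\<Sum>i\<in>I. linear_extension \<psi> (f i))"
  by (induction I rule: infinite_finite_induct) (auto simp: linear_extension_add)

lemma linear_extension_mult:
  assumes "\<And>u v. u \<in> Poly_Mapping.keys f \<Longrightarrow> v \<in> Poly_Mapping.keys g \<Longrightarrow> \<psi> (u + v) = \<theta> u * \<phi> v"
  shows "linear_extension \<psi> (f * g) = linear_extension \<theta> f * linear_extension \<phi> g"
proof -
  let ?F = "Poly_Mapping.keys f" and ?G = "Poly_Mapping.keys g"
  have "f * g = (\<Sum>u\<in>?F. Poly_Mapping.single u (coeff f u)) * (\<Sum>v\<in>?G. Poly_Mapping.single v (coeff g v))"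
    by (simp flip: poly_mapping_eq_sum_single)
  also have "\<dots> = (\<Sum>u\<in>?F. \<Sum>v\<in>?G. Poly_Mapping.single (u + v) (coeff f u * coeff g v))"
    by (simp add: sum_product mult_single)
  finally have "linear_extension \<psi> (f * g) = (\<Sum>u\<in>?F. \<Sum>v\<in>?G. coeff f u * coeff g v * \<psi> (u + v))"
    by (simp add: linear_extension_sum)
  also have "\<dots> = (\<Sum>u\<in>?F. \<Sum>v\<in>?G. (coeff f u * \<theta> u) * (coeff g v * \<phi> v))"
    using assms by (intro sum.cong refl) (simp add: mult_ac)
  finally show ?thesis by (simp add: linear_extension_def sum_product)
qed

context ray_coordinates
begin

text \<open>
  An element of \<open>nfold_sums S (n0 + k)\<close> splits off \<open>k\<close> extremal generators, so its weight is at least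
  \<open>k M\<close>. Applied to large multiples of a single nonzero \<open>u\<close>, this forces \<open>weight u \<ge> M\<close>: the
  constant \<open>n0\<close> is negligible in the limit.
\<close>

lemma weight_ge_if_rays_reduction:
  assumes red: "\<And>n. n0 \<le> n \<Longrightarrow> nfold_sums S (Suc n) = (range \<alpha> + S) + nfold_sums S n"
    and "u \<in> nfold_sums S n"
  shows "n * M \<le> weight u"
proof -
  have late: "k * M \<le> weight u" if "u \<in> nfold_sums S (n0 + k)" for k u
    using that
  proof (induction k arbitrary: u)
    case (Suc k)
    then obtain i s v where *: "u = (\<alpha> i + s) + v" "s \<in> S" "v \<in> nfold_sums S (n0 + k)"
      using red[of "n0 + k"] by (simp del: nfold_sums.simps) (auto simp: set_plus_def)
    then have "v \<in> S" using nfold_sums_subset[OF submonoid] by blast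
    then show ?case using * Suc.IH[of v] by (simp add: weight_add ray_in add_in weight_ray)
  qed simp
  have nonzero: "M \<le> weight u" if u: "u \<in> S" "u \<noteq> 0" for u
  proof (rule ccontr)
    assume "\<not> M \<le> weight u"
    then have "Suc (weight u) \<le> M" by simp
    \<comment> \<open>Large enough that \<open>(n0 + k) * weight u < k * (weight u + 1)\<close>.\<close>
    define k where "k = Suc (n0 * weight u)"
    have "k * M \<le> (n0 + k) * weight u"
      using late smult_in_nfold_sums[OF submonoid u] weight_smult[OF u(1)] by metis
    moreover have "k * Suc (weight u) \<le> k * M" using \<open>Suc (weight u) \<le> M\<close> by (rule mult_le_mono2)
    ultimately show False by (simp add: k_def algebra_simps)
  qed
  show ?thesis
    using assms(2)
  proof (induction n arbitrary: u)
    case (Suc n)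
    then obtain x v where *: "u = x + v" "x \<in> S" "x \<noteq> 0" "v \<in> nfold_sums S n"
      by (auto simp: set_plus_def)
    then have "v \<in> S" using nfold_sums_subset[OF submonoid] by blast
    then show ?case using * Suc.IH[of v] nonzero[of x] by (simp add: weight_add)
  qed simp
qed

text \<open>
  Evaluation at the point \<open>c\<close> of the monomials of degree \<open>n\<close> in the \<open>x^(\<alpha> i)\<close>, extended by zero to
  all other monomials: \<open>b\<close> is a natural combination of the \<open>\<alpha> i\<close> exactly when \<open>M\<close> divides all its
  scaled coordinates.
\<close>

definition ray_character :: "('d \<Rightarrow> 'k::field) \<Rightarrow> nat \<Rightarrow> nat ^ 'd \<Rightarrow> 'k" where
  "ray_character c n b =
     (if weight b = n * M \<and> (\<forall>i. M dvd q b i) then \<Prod>i\<in>UNIV. c i ^ (q b i div M) else 0)"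

lemma ray_character_ray_add:
  assumes "v \<in> S"
  shows "ray_character c (Suc n) (\<alpha> i + v) = c i * ray_character c n v"
proof -
  have q: "q (\<alpha> i + v) j = (if i = j then M else 0) + q v j" for j
    using assms by (simp add: q_add ray_in q_ray)
  have "weight (\<alpha> i + v) = Suc n * M \<longleftrightarrow> weight v = n * M"
    using assms by (simp add: weight_add ray_in weight_ray)
  moreover have "(\<forall>j. M dvd q (\<alpha> i + v) j) \<longleftrightarrow> (\<forall>j. M dvd q v j)"
    by (simp add: q)
  moreover have "(\<Prod>j\<in>UNIV. c j ^ (q (\<alpha> i + v) j div M)) = c i * (\<Prod>j\<in>UNIV. c j ^ (q v j div M))"
  proof -
    have "c j ^ (q (\<alpha> i + v) j div M) = (if j = i then c j else 1) * c j ^ (q v j div M)" for j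
      using M_pos by (simp add: q)
    then show ?thesis by (simp add: prod.distrib)
  qed
  ultimately show ?thesis unfolding ray_character_def by simp
qed

text \<open>
  The vectors of coefficients at the \<open>\<alpha> i\<close> form a subspace \<open>V\<close>. That \<open>V\<close> is the whole space comes
  from the evaluation functional \<open>ray_character\<close>; descending induction along the powers of \<open>m\<close>, in the
  manner of Nakayama's lemma, then puts every \<open>x^(\<alpha> i)\<close> into \<open>J\<close>.
\<close>

lemma rays_ideal_minimal:
  fixes J :: "((nat ^ 'd) \<Rightarrow>\<^sub>0 'k::field) set"
  assumes E: "reduction_ideal (semigroup_algebra S) (monomial_span (S - {0}))
      (monomial_span (range \<alpha> + S) :: ((nat ^ 'd) \<Rightarrow>\<^sub>0 'k) set)"
    and J: "reduction_ideal (semigroup_algebra S) (monomial_span (S - {0})) J"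
    and JE: "J \<subseteq> monomial_span (range \<alpha> + S)"
  shows "monomial_span (range \<alpha> + S) \<subseteq> J"
proof -
  have idJ: "ideal J (semigroup_algebra S)"
    using J by (simp add: reduction_ideal_semigroup_algebra_iff[OF submonoid])
  then have J0: "0 \<in> J" and Jadd: "\<And>f g. f \<in> J \<Longrightarrow> g \<in> J \<Longrightarrow> f + g \<in> J"
    and Jmult: "\<And>r f. r \<in> monomial_span S \<Longrightarrow> f \<in> J \<Longrightarrow> r * f \<in> J"
    by (auto simp: ideal_semigroup_algebra_iff[OF submonoid] submonoid_add_def)
  obtain n where n: "monomial_span (nfold_sums S (Suc n)) =
      J \<cdot>\<^bsub>semigroup_algebra S\<^esub> monomial_span (nfold_sums S n)"
    using J by (auto simp: reduction_ideal_semigroup_algebra_iff[OF submonoid] eventually_sequentially)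
  obtain n0 where n0: "\<And>n. n0 \<le> n \<Longrightarrow> nfold_sums S (Suc n) = (range \<alpha> + S) + nfold_sums S n"
    using reduction_ideal_monomial_spanD[OF submonoid E] by blast
  have weight_ge: "m * M \<le> weight u" if "u \<in> nfold_sums S m" for m u
    by (rule weight_ge_if_rays_reduction[OF n0 that])
  define V where "V = {(\<chi> i. coeff f (\<alpha> i)) |f. f \<in> J}"
  have "vec.subspace V"
    unfolding vec.subspace_def
  proof (intro conjI ballI allI)
    show "0 \<in> V" using J0 by (auto simp: V_def vec_eq_iff intro!: exI[of _ 0])
    fix x assume "x \<in> V"
    then obtain f where f: "f \<in> J" "x = (\<chi> i. coeff f (\<alpha> i))" by (auto simp: V_def)
    show "a *s x \<in> V" for a
    proof -
      have "Poly_Mapping.single 0 a * f \<in> J"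
        using f by (intro Jmult single_in_monomial_span zero_in)
      moreover have "a *s x = (\<chi> i. coeff (Poly_Mapping.single 0 a * f) (\<alpha> i))"
        unfolding f(2) mult_map_scale_conv_mult[symmetric] by (simp add: map.rep_eq when_def vec_eq_iff)
      ultimately show ?thesis unfolding V_def by blast
    qed
    fix y assume "y \<in> V"
    then obtain g where g: "g \<in> J" "y = (\<chi> i. coeff g (\<alpha> i))" by (auto simp: V_def)
    have "x + y = (\<chi> i. coeff (f + g) (\<alpha> i))" by (simp add: f g vec_eq_iff lookup_add)
    then show "x + y \<in> V" using Jadd[OF f(1) g(1)] unfolding V_def by blast
  qed
  have "V = UNIV"
  proof (rule ccontr)
    assume "V \<noteq> UNIV"
    with \<open>vec.subspace V\<close> obtain c :: "'d \<Rightarrow> 'k" where c: "\<exists>i. c i \<noteq> 0"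
      "\<And>v. v \<in> V \<Longrightarrow> (\<Sum>i\<in>UNIV. c i * v $ i) = 0"
      by (rule proper_subspace_annihilator) blast
    obtain i where i: "c i \<noteq> 0" using c by blast
    \<comment> \<open>\<open>pick\<close> is the linear form \<open>c\<close> on the span of the \<open>x^(\<alpha> i)\<close>, extended by zero to the other
      monomials.\<close>
    define pick where "pick u = (\<Sum>i\<in>UNIV. if u = \<alpha> i then c i else 0)" for u
    have pick_ray: "pick (\<alpha> i) = c i" for i
      by (simp add: pick_def inj_ray)
    have pick: "linear_extension pick f = 0" if "f \<in> J" for f
    proof -
      have "linear_extension pick f =
          (\<Sum>i\<in>UNIV. \<Sum>b\<in>Poly_Mapping.keys f. if b = \<alpha> i then coeff f b * c i else 0)"
        unfolding linear_extension_def pick_def sum_distrib_left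
        by (subst sum.swap) (simp add: if_distrib cong: if_cong)
      also have "\<dots> = (\<Sum>i\<in>UNIV. c i * (\<chi> i. coeff f (\<alpha> i)) $ i)"
        by (intro sum.cong) (auto simp: in_keys_iff)
      also have "\<dots> = 0" using that by (intro c) (auto simp: V_def)
      finally show ?thesis .
    qed
    \<comment> \<open>By the weight bound, a sum of least weight \<open>Suc n * M\<close> can only consist of some \<open>\<alpha> i\<close> and an
      element of weight \<open>n * M\<close>.\<close>
    have char_mult: "ray_character c (Suc n) (u + v) = pick u * ray_character c n v"
      if "u \<in> range \<alpha> + S" "v \<in> nfold_sums S n" for u v
    proof -
      obtain i s where u: "u = \<alpha> i + s" "s \<in> S" using \<open>u \<in> range \<alpha> + S\<close> by (auto simp: set_plus_def)
      have v: "v \<in> S" "n * M \<le> weight v"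
        using that weight_ge nfold_sums_subset[OF submonoid] by blast+
      show ?thesis
      proof (cases "s = 0")
        case True
        then show ?thesis using u v by (simp add: pick_ray ray_character_ray_add)
      next
        case False
        have "M \<le> weight s"
          using weight_ge[OF in_nfold_sums_1[OF submonoid u(2) False]] by simp
        then have "weight (u + v) \<noteq> Suc n * M"
          using u v M_pos by (simp add: weight_add add_in ray_in weight_ray)
        moreover have "u \<noteq> \<alpha> j" for j
          using ray_irreducible[of j "\<alpha> i" s] u False ray_in ray_nonzero by metis
        ultimately show ?thesis by (simp add: ray_character_def pick_def)
      qed
    qed
    let ?\<psi> = "linear_extension (ray_character c (Suc n))"
    have "J \<cdot>\<^bsub>semigroup_algebra S\<^esub> monomial_span (nfold_sums S n) \<subseteq> {f. ?\<psi> f = 0}"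
    proof (rule ideal_prod_subsetI)
      show "submonoid_add {f. ?\<psi> f = 0}" by (simp add: submonoid_add_def linear_extension_add)
      fix f g :: "(nat ^ 'd) \<Rightarrow>\<^sub>0 'k"
      assume f: "f \<in> J" and g: "g \<in> monomial_span (nfold_sums S n)"
      have "?\<psi> (f * g) = linear_extension pick f * linear_extension (ray_character c n) g"
        using f g JE by (intro linear_extension_mult char_mult) (auto simp: monomial_span_def)
      then show "f * g \<in> {f. ?\<psi> f = 0}" using pick[OF f] by simp
    qed
    then have vanish: "?\<psi> f = 0" if "f \<in> monomial_span (nfold_sums S (Suc n))" for f
      using that n by blast
    have "ray_character c k (k *s \<alpha> i) = c i ^ k \<and> k *s \<alpha> i \<in> S" for k
    proof (induction k)
      case 0
      then show ?case by (simp add: ray_character_def weight_def q_zero zero_in)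
    next
      case (Suc k)
      then show ?case by (simp add: Suc_smult_nat_vec ray_character_ray_add add_in ray_in)
    qed
    then have "?\<psi> (monomial (Suc n *s \<alpha> i)) = c i ^ Suc n"
      unfolding monomial_def linear_extension_single by simp
    moreover have "?\<psi> (monomial (Suc n *s \<alpha> i)) = 0"
      using smult_in_nfold_sums[OF submonoid ray_in ray_nonzero] by (intro vanish) (simp del: nfold_sums.simps)
    ultimately show False using i by simp
  qed
  \<comment> \<open>Modulo \<open>J\<close>, each \<open>x^(\<alpha> i)\<close> can be pushed into \<open>m E\<close>, and repeatedly so until it lands in a power
    of \<open>m\<close> contained in \<open>J\<close>.\<close>
  have "range \<alpha> + nfold_sums S k \<subseteq> {b. monomial b \<in> J}" if "k \<le> Suc n" for k
    using that
  proof (induction k rule: inc_induct)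
    case base
    have "range \<alpha> \<subseteq> S" using ray_in by blast
    then have "range \<alpha> + nfold_sums S (Suc n) \<subseteq> nfold_sums S (Suc n)"
      using set_plus_mono2[of "range \<alpha>" S] nfold_sums_absorb[OF submonoid] by blast
    moreover have "monomial_span (nfold_sums S (Suc n)) \<subseteq> J"
      unfolding n
    proof (rule ideal_prod_subsetI)
      show "submonoid_add J" using J0 Jadd by (simp add: submonoid_add_def)
      fix f g :: "(nat ^ 'd) \<Rightarrow>\<^sub>0 'k"
      assume "f \<in> J" "g \<in> monomial_span (nfold_sums S n)"
      then show "f * g \<in> J"
        using Jmult monomial_span_mono[OF nfold_sums_subset[OF submonoid]] by (metis mult.commute subsetD)
    qed
    ultimately show ?case using monomial_in_monomial_span_iff by blast
  next
    case (step k)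
    show ?case
    proof safe
      fix b assume "b \<in> range \<alpha> + nfold_sums S k"
      then obtain i u where b: "b = \<alpha> i + u" "u \<in> nfold_sums S k" by (auto simp: set_plus_def)
      have "axis i 1 \<in> V" using \<open>V = UNIV\<close> by blast
      then obtain f where f: "f \<in> J" "\<And>j. coeff f (\<alpha> j) = axis i 1 $ j"
        unfolding V_def by (auto simp: vec_eq_iff)
      let ?h = "monomial (\<alpha> i) - f"
      have "?h \<in> monomial_span (range \<alpha> + (S - {0}))"
        unfolding in_monomial_span_iff
      proof (intro allI impI)
        fix x assume x: "coeff ?h x \<noteq> 0"
        have "x \<noteq> \<alpha> j" for j
          using x f(2)[of j] by (auto simp: lookup_minus coeff_monomial axis_def inj_ray split: if_splits)
        moreover have "x \<in> range \<alpha> + S"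
        proof (cases "coeff f x = 0")
          case True
          then have "x = \<alpha> i + 0" using x by (simp add: lookup_minus coeff_monomial split: if_splits)
          then show ?thesis using zero_in by (metis rangeI set_plus_intro)
        next
          case False
          then show ?thesis using f JE by (auto simp: in_monomial_span_iff)
        qed
        ultimately show "x \<in> range \<alpha> + (S - {0})"
          by (force simp: set_plus_def)
      qed
      moreover have "monomial u \<in> (monomial_span (nfold_sums S k) :: ((nat ^ 'd) \<Rightarrow>\<^sub>0 'k) set)"
        using b by simp
      ultimately have "?h * monomial u \<in> monomial_span (range \<alpha> + (S - {0}) + nfold_sums S k)"
        by (rule times_in_monomial_span)
      also have "\<dots> \<subseteq> J"
        using step.IH by (intro monomial_span_subset_ideal[OF submonoid idJ]) (auto simp: add.assoc)
      finally have "?h * monomial u \<in> J" .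
      moreover have "u \<in> S" using b nfold_sums_subset[OF submonoid] by blast
      then have "monomial u * f \<in> J" by (intro Jmult f) simp
      ultimately have "?h * monomial u + monomial u * f \<in> J" by (rule Jadd)
      then show "monomial b \<in> J" by (simp add: b monomial_add algebra_simps)
    qed
  qed
  from this[of 0] show ?thesis
    by (intro monomial_span_subset_ideal[OF submonoid idJ]) auto
qed

end

context ray_coordinates
begin

section \<open>Monomial minimal reductions\<close>

text \<open>
  For \<open>c \<notin> range \<alpha>\<close> and indecomposable in \<open>T\<close>, this is a hyperplane in the ideal spanned by \<open>T\<close>. For
  \<open>\<tau> = 0\<close> it omits \<open>x^c\<close>; for \<open>\<tau> = 1\<close> it is spanned by the differences \<open>x^(\<alpha> i) - x^c\<close> and the
  monomials of \<open>T\<close> other than \<open>x^c\<close> and the \<open>x^(\<alpha> i)\<close>.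
\<close>

definition hyperplane_ideal ::
    "(nat ^ 'd) set \<Rightarrow> nat ^ 'd \<Rightarrow> 'k::field \<Rightarrow> ((nat ^ 'd) \<Rightarrow>\<^sub>0 'k) set" where
  "hyperplane_ideal T c \<tau> =
     {f \<in> monomial_span T. coeff f c + \<tau> * (\<Sum>i\<in>UNIV. coeff f (\<alpha> i)) = 0}"

text \<open>
  In \<open>(n + 1) \<alpha> i = t + v\<close> with \<open>v \<in> nfold_sums S n\<close> both summands lie on the ray, so \<open>t \<ge> \<alpha> i\<close> and
  \<open>v \<ge> n \<alpha> i\<close>; therefore equality holds in both.
\<close>

lemma rays_in_reduction:
  assumes "T \<subseteq> S" "0 \<notin> T" "\<forall>n\<ge>n0. nfold_sums S (Suc n) = T + nfold_sums S n"
  shows "\<alpha> i \<in> T"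
proof -
  have "Suc n0 *s \<alpha> i \<in> T + nfold_sums S n0"
    using smult_in_nfold_sums[OF submonoid ray_in ray_nonzero, of "Suc n0" i] assms(3)
    by (metis order_refl)
  then obtain t v where tv: "Suc n0 *s \<alpha> i = t + v" "t \<in> T" "v \<in> nfold_sums S n0"
    by (auto simp: set_plus_def)
  have S: "t \<in> S" "t \<noteq> 0" "v \<in> S" using tv assms nfold_sums_subset[OF submonoid] by blast+
  have mult: "k *s \<alpha> i \<in> S \<and> q (k *s \<alpha> i) j = (if i = j then k * M else 0)" for k j
  proof (induction k)
    case (Suc k)
    then show ?case by (auto simp: Suc_smult_nat_vec q_add ray_in add_in q_ray)
  qed (simp add: zero_in q_zero)
  have "q t j = 0" "q v j = 0" if "j \<noteq> i" for j
    using mult[of "Suc n0" j] that S unfolding tv(1) by (auto simp: q_add)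
  then have "\<alpha> i \<le> t" "n0 *s \<alpha> i \<le> v"
    using ray_least S smult_ray_le[OF tv(3)] by blast+
  then have "t $ j = \<alpha> i $ j" for j
    using arg_cong[OF tv(1), of "\<lambda>w. w $ j"]
    by (simp add: less_eq_vec_def) (metis add_le_cancel_right add_mono le_antisym nle_le add_left_mono)
  then have "t = \<alpha> i" by (simp add: vec_eq_iff)
  then show ?thesis using tv by simp
qed

lemma ray_not_decomposable:
  assumes "T \<subseteq> S" "0 \<notin> T"
  shows "\<alpha> i \<notin> (S - {0}) + T"
proof
  assume "\<alpha> i \<in> (S - {0}) + T"
  then obtain u v where "\<alpha> i = u + v" "u \<in> S" "u \<noteq> 0" "v \<in> T" by (auto simp: set_plus_def)
  then show False using ray_irreducible[of i u v] assms by blast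
qed

lemma ideal_hyperplane_ideal:
  assumes T: "T \<subseteq> S" "0 \<notin> T" "S + T \<subseteq> T" and c: "c \<notin> (S - {0}) + T"
  shows "ideal (hyperplane_ideal T c \<tau>) (semigroup_algebra S)"
proof -
  have T': "ideal (monomial_span T) (semigroup_algebra S)"
    using T by (intro ideal_monomial_span submonoid)
  have "coeff (r * f) c + \<tau> * (\<Sum>i\<in>UNIV. coeff (r * f) (\<alpha> i)) =
      coeff r 0 * (coeff f c + \<tau> * (\<Sum>i\<in>UNIV. coeff f (\<alpha> i)))"
    if "r \<in> monomial_span S" "f \<in> monomial_span T" for r f
    by (simp add: coeff_times_indecomposable[OF submonoid c that]
        coeff_times_indecomposable[OF submonoid ray_not_decomposable[OF T(1,2)] that]
        distrib_left mult.left_commute flip: sum_distrib_left)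
  moreover have "submonoid_add (hyperplane_ideal T c \<tau>)"
    using submonoid_add_monomial_span[of T]
    by (auto simp: submonoid_add_def hyperplane_ideal_def lookup_add sum.distrib algebra_simps
        add_eq_0_iff)
  ultimately show ?thesis
    using T' unfolding ideal_semigroup_algebra_iff[OF submonoid] hyperplane_ideal_def by auto
qed

text \<open>
  Fix \<open>n\<close> large and let \<open>P\<close> be the product of the hyperplane ideal with \<open>m^n\<close>. Modulo \<open>P\<close>, a monomial
  of \<open>T\<close> times an element of \<open>m^n\<close> either vanishes or may be replaced by \<open>x^c\<close> times that element
  (\<open>replace\<close>), so everything reduces to \<open>x^(N c) m^(n + 1 - N) \<subseteq> P\<close> for one \<open>N\<close> (\<open>start\<close>).
  If \<open>weight c \<ge> M\<close>, take \<open>N = M\<close>: the element \<open>M c = \<Sum> q c i \<alpha> i\<close> is a sum of at least \<open>M\<close>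
  extremal generators, and these are exponents of the hyperplane ideal for \<open>\<tau> = 0\<close>. If
  \<open>weight c < M\<close>, take \<open>N = weight c\<close>: for \<open>\<tau> = 1\<close> the \<open>N\<close> extremal generators in this sum can be
  exchanged one by one for \<open>c\<close>, while the sum itself is \<open>M > N\<close> times \<open>c\<close> and so lies one power of \<open>m\<close>
  deeper than expected, hence in \<open>P\<close> (\<open>deep\<close>).
\<close>

lemma hyperplane_ideal_reduction:
  fixes \<tau> :: "'k::field"
  assumes T: "T \<subseteq> S" "0 \<notin> T" "S + T \<subseteq> T"
    and n0: "\<And>n. n0 \<le> n \<Longrightarrow> nfold_sums S (Suc n) = T + nfold_sums S n"
    and c: "c \<in> T" "c \<notin> (S - {0}) + T" "c \<notin> range \<alpha>"
    and \<tau>: "M \<le> weight c \<and> \<tau> = 0 \<or> weight c < M \<and> \<tau> = 1"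
  shows "reduction_ideal (semigroup_algebra S) (monomial_span (S - {0})) (hyperplane_ideal T c \<tau>)"
proof -
  let ?J = "hyperplane_ideal T c \<tau>"
  let ?R = "semigroup_algebra S :: ((nat ^ 'd) \<Rightarrow>\<^sub>0 'k) ring"
  interpret R: cring ?R by (rule cring_semigroup_algebra[OF submonoid])
  have rays: "\<alpha> i \<in> T" for i using rays_in_reduction T n0 by blast
  have idJ: "ideal ?J ?R" using T c by (intro ideal_hyperplane_ideal)
  have TS: "T \<subseteq> S - {0}" using T by blast
  have JT: "?J \<subseteq> monomial_span T" by (auto simp: hyperplane_ideal_def)
  have cS: "c \<in> S" "c \<noteq> 0" using c TS by auto
  have monJ: "monomial b \<in> ?J" if "b \<in> T" "b \<noteq> c" "\<tau> = 0 \<or> b \<notin> range \<alpha>" for b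
  proof -
    have "\<tau> = 0 \<or> (\<forall>i. b \<noteq> \<alpha> i)" using that(3) by blast
    then show ?thesis using that(1,2) by (auto simp: hyperplane_ideal_def coeff_monomial)
  qed
  have difJ: "monomial (\<alpha> i) - monomial c \<in> ?J" "monomial c - monomial (\<alpha> i) \<in> ?J" if "\<tau> = 1" for i
  proof -
    have "monomial (\<alpha> i) - monomial c \<in> (monomial_span T :: ((nat ^ 'd) \<Rightarrow>\<^sub>0 'k) set)"
      "monomial c - monomial (\<alpha> i) \<in> (monomial_span T :: ((nat ^ 'd) \<Rightarrow>\<^sub>0 'k) set)"
      using rays c by (auto simp: in_monomial_span_iff lookup_minus coeff_monomial split: if_splits)
    moreover have "c \<noteq> \<alpha> j" "\<alpha> j \<noteq> c" for j using c by auto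
    ultimately show "monomial (\<alpha> i) - monomial c \<in> ?J" "monomial c - monomial (\<alpha> i) \<in> ?J"
      using that by (auto simp: hyperplane_ideal_def lookup_minus coeff_monomial sum_subtractf sum_negf inj_ray)
  qed
  define N where "N = (if \<tau> = 0 then M else weight c)"
  have power: "monomial_span (nfold_sums S (Suc n)) = ?J \<cdot>\<^bsub>?R\<^esub> monomial_span (nfold_sums S n)"
    if n: "n0 + N \<le> n" for n
  proof
    let ?P = "?J \<cdot>\<^bsub>?R\<^esub> monomial_span (nfold_sums S n)"
    have "?P \<subseteq> monomial_span T \<cdot>\<^bsub>?R\<^esub> monomial_span (nfold_sums S n)"
      using JT by (intro ideal_prod_subsetI) (auto simp: ideal_prod_monomial_span submonoid_add_monomial_span
          intro: times_in_monomial_span)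
    then show "?P \<subseteq> monomial_span (nfold_sums S (Suc n))"
      using n0[of n] n by (simp add: ideal_prod_monomial_span)
    have idP: "ideal ?P ?R"
      using idJ nfold_sums_subset[OF submonoid] nfold_sums_absorb[OF submonoid]
      by (intro R.ideal_prod_is_ideal ideal_monomial_span submonoid) auto
    have Padd: "f + g \<in> ?P" if "f \<in> ?P" "g \<in> ?P" for f g
      using ideal_prod.sum[OF that] by simp
    \<comment> \<open>With \<open>I\<close> spanned by \<open>T\<close>, the ideal \<open>m^(n+2) = (m I) m^n\<close> lies in \<open>P\<close>, since the exponents of
      \<open>m I\<close> are decomposable and the
      hyperplane condition concerns only indecomposable ones.\<close>
    have deep: "monomial b \<in> ?P" if b: "b \<in> nfold_sums S (Suc (Suc n))" for b
    proof -
      have "b \<in> ((S - {0}) + T) + nfold_sums S n"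
        using b n0[of n] n by (simp add: add.assoc)
      then obtain x w where x: "b = x + w" "x \<in> (S - {0}) + T" "w \<in> nfold_sums S n"
        by (auto simp: set_plus_def)
      have "x \<in> S + T" using x(2) set_plus_mono2[of "S - {0}" S T T] by blast
      then have "monomial x \<in> ?J"
        using x(2) c ray_not_decomposable[OF T(1,2)] T(3) by (intro monJ) auto
      then show ?thesis
        unfolding x(1) monomial_add using x(3) by (intro times_in_ideal_prod) auto
    qed
    have replace: "monomial (t + w) \<in> ?P"
      if "t \<in> T" "w \<in> nfold_sums S n" "monomial (c + w) \<in> ?P" for t w
    proof (cases "t = c \<or> \<tau> \<noteq> 0 \<and> t \<in> range \<alpha>")
      case True
      then show ?thesis
      proof
        assume "\<tau> \<noteq> 0 \<and> t \<in> range \<alpha>"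
        then obtain i where "t = \<alpha> i" "\<tau> = 1" using \<tau> by auto
        then have "(monomial t - monomial c) * monomial w \<in> ?P"
          using that difJ by (intro times_in_ideal_prod) auto
        from Padd[OF this that(3)] show ?thesis by (simp add: monomial_add algebra_simps)
      qed (use that in simp)
    next
      case False
      then show ?thesis
        unfolding monomial_add using that monJ by (intro times_in_ideal_prod) auto
    qed
    have start: "monomial (N *s c + v) \<in> ?P" if v: "v \<in> nfold_sums S (Suc n - N)" for v
    proof (cases "\<tau> = 0")
      case True
      then have w: "M \<le> weight c" "N = M" using \<tau> by (auto simp: N_def)
      obtain i where i: "0 < q c i"
        using w M_pos by (auto simp: weight_def) (metis not_gr_zero sum.neutral not_less)
      let ?m = "(q c)(i := q c i - 1)"
      note peel = sum_rays_peel[where m = "q c", OF i]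
      have "M - 1 \<le> (\<Sum>j\<in>UNIV. ?m j)" using w peel(2) by (simp add: weight_def)
      then have "(\<Sum>j\<in>UNIV. ?m j *s \<alpha> j) \<in> nfold_sums S (M - 1)"
        using sum_rays_in_nfold_sums nfold_sums_antimono[OF submonoid] by blast
      then have "(\<Sum>j\<in>UNIV. ?m j *s \<alpha> j) + v \<in> nfold_sums S (M - 1 + (Suc n - N))"
        using v by (intro add_in_nfold_sums submonoid)
      moreover have "M - 1 + (Suc n - N) = n" using w n M_pos by simp
      moreover have "monomial (\<alpha> i) \<in> ?J" using True rays c by (intro monJ) auto
      ultimately have "monomial (\<alpha> i) * monomial ((\<Sum>j\<in>UNIV. ?m j *s \<alpha> j) + v) \<in> ?P"
        by (intro times_in_ideal_prod) auto
      then show ?thesis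
        unfolding w(2) q_expand[OF cS(1)] peel(1) by (simp only: monomial_add mult.assoc)
    next
      case False
      then have w: "weight c < M" "\<tau> = 1" "N = weight c" using \<tau> by (auto simp: N_def)
      have exchange: "monomial (k *s c + (\<Sum>i\<in>UNIV. m i *s \<alpha> i) + v) \<in> ?P \<Longrightarrow>
          monomial (N *s c + v) \<in> ?P" if "k + (\<Sum>i\<in>UNIV. m i) = N" for k m
        using that
      proof (induction "\<Sum>i\<in>UNIV. m i" arbitrary: m k)
        case 0
        then show ?case by simp
      next
        case (Suc l)
        obtain i where i: "0 < m i"
          using Suc.hyps(2) by (metis not_gr_zero sum.neutral nat.distinct(1))
        let ?m = "m(i := m i - 1)"
        let ?w = "k *s c + (\<Sum>j\<in>UNIV. ?m j *s \<alpha> j) + v"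
        note peel = sum_rays_peel[where m = m, OF i]
        have "?w \<in> nfold_sums S (k + (\<Sum>j\<in>UNIV. ?m j) + (Suc n - N))"
          using v by (intro add_in_nfold_sums submonoid sum_rays_in_nfold_sums smult_in_nfold_sums cS)
        moreover have "k + (\<Sum>j\<in>UNIV. ?m j) + (Suc n - N) = n"
          using Suc.prems(2) peel(2) n by simp
        ultimately have difP: "(monomial c - monomial (\<alpha> i)) * monomial ?w \<in> ?P"
          using difJ w by (intro times_in_ideal_prod) auto
        have rayP: "monomial (\<alpha> i) * monomial ?w \<in> ?P"
          using Suc.prems(1) unfolding peel(1) by (simp only: monomial_add mult_ac)
        have "monomial c * monomial ?w \<in> ?P"
          using Padd[OF difP rayP] by (simp only: left_diff_distrib diff_add_cancel)
        then have "monomial (Suc k *s c + (\<Sum>j\<in>UNIV. ?m j *s \<alpha> j) + v) \<in> ?P"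
          unfolding Suc_smult_nat_vec by (simp only: monomial_add mult_ac)
        then show ?case
          using Suc.hyps(1)[of ?m "Suc k"] Suc.hyps(2) Suc.prems(2) peel(2) by simp
      qed
      have "0 < N"
      proof (rule ccontr)
        assume "\<not> 0 < N"
        then have "q c i = 0" for i using w by (simp add: weight_def)
        then have "M *s c = 0" using q_expand[OF cS(1)] by simp
        then show False using M_pos cS by (auto simp: vec_eq_iff)
      qed
      have "M *s c + v \<in> nfold_sums S (M + (Suc n - N))"
        using v by (intro add_in_nfold_sums submonoid smult_in_nfold_sums cS)
      moreover have "Suc (Suc n) \<le> M + (Suc n - N)" using w n by simp
      ultimately have "M *s c + v \<in> nfold_sums S (Suc (Suc n))"
        using nfold_sums_antimono[OF submonoid] by blast
      then have "monomial (0 *s c + (\<Sum>i\<in>UNIV. q c i *s \<alpha> i) + v) \<in> ?P"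
        using deep q_expand[OF cS(1)] by simp
      then show ?thesis using exchange[of 0 "q c"] w by (simp add: weight_def)
    qed
    \<comment> \<open>Descending from \<open>k = N\<close> to \<open>k = 0\<close>: while \<open>n - k \<ge> n0\<close>, one more element \<open>t\<close> of \<open>T\<close> splits off
      and is traded for \<open>c\<close>.\<close>
    have "\<forall>v\<in>nfold_sums S (Suc n - k). monomial (k *s c + v) \<in> ?P" if "k \<le> N" for k
      using that
    proof (induction k rule: inc_induct)
      case base
      then show ?case using start by blast
    next
      case (step k)
      show ?case
      proof
        fix v assume "v \<in> nfold_sums S (Suc n - k)"
        then have "v \<in> T + nfold_sums S (n - k)"
          using n0[of "n - k"] n step.hyps by (simp add: Suc_diff_le)
        then obtain t w where tw: "v = t + w" "t \<in> T" "w \<in> nfold_sums S (n - k)"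
          by (auto simp: set_plus_def)
        have "k *s c + w \<in> nfold_sums S (k + (n - k))"
          using tw by (intro add_in_nfold_sums submonoid smult_in_nfold_sums cS)
        then have "k *s c + w \<in> nfold_sums S n" using n step.hyps by simp
        moreover have "monomial (c + (k *s c + w)) \<in> ?P"
          using step.IH tw by (simp add: Suc_smult_nat_vec add.assoc)
        ultimately have "monomial (t + (k *s c + w)) \<in> ?P"
          by (rule replace[OF tw(2)])
        then show "monomial (k *s c + v) \<in> ?P" by (simp add: tw(1) add_ac)
      qed
    qed
    from this[of 0] show "monomial_span (nfold_sums S (Suc n)) \<subseteq> ?P"
      by (intro monomial_span_subset_ideal[OF submonoid idP]) auto
  qed
  show ?thesis
    unfolding reduction_ideal_semigroup_algebra_iff[OF submonoid] eventually_sequentially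
    using idJ JT monomial_span_mono[OF TS] power by blast
qed

text \<open>
  An exponent \<open>c\<close> of least degree among those of \<open>T\<close> outside \<open>range \<alpha> + S\<close> is indecomposable, because
  a proper summand of \<open>c\<close> in \<open>T\<close> is smaller and would already lie in \<open>range \<alpha> + S\<close>. The
  hyperplane ideal at \<open>c\<close> is then a reduction without \<open>x^c\<close>.
\<close>

lemma monomial_minimal_reduction_eq_rays_ideal:
  assumes T: "T \<subseteq> S" "S + T \<subseteq> T"
    and min: "minimal_reduction_ideal (semigroup_algebra S) (monomial_span (S - {0}))
      (monomial_span T :: ((nat ^ 'd) \<Rightarrow>\<^sub>0 'k::field) set)"
  shows "T = range \<alpha> + S"
proof (rule ccontr)
  assume ne: "T \<noteq> range \<alpha> + S"
  have red: "reduction_ideal (semigroup_algebra S) (monomial_span (S - {0}))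
      (monomial_span T :: ((nat ^ 'd) \<Rightarrow>\<^sub>0 'k) set)"
    using min by (simp add: minimal_reduction_ideal_def)
  obtain n0 where n0: "\<forall>n\<ge>n0. nfold_sums S (Suc n) = T + nfold_sums S n"
    using reduction_ideal_monomial_spanD[OF submonoid red] by blast
  have "T \<subseteq> S - {0}"
    using red by (simp add: reduction_ideal_semigroup_algebra_iff[OF submonoid] monomial_span_subset_iff)
  then have zero: "0 \<notin> T" by blast
  have rays: "range \<alpha> \<subseteq> T" using rays_in_reduction[OF T(1) zero n0] by blast
  have "range \<alpha> + S \<subseteq> T"
    using set_plus_mono2[OF rays, of S S] T(2) by (simp add: add.commute)
  then have "\<exists>c. c \<in> T \<and> c \<notin> range \<alpha> + S" using ne by blast
  then obtain c where c: "c \<in> T" "c \<notin> range \<alpha> + S"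
    and least: "\<And>x. x \<in> T \<and> x \<notin> range \<alpha> + S \<Longrightarrow> (\<Sum>i\<in>UNIV. c $ i) \<le> (\<Sum>i\<in>UNIV. x $ i)"
    using ex_has_least_nat[of "\<lambda>c. c \<in> T \<and> c \<notin> range \<alpha> + S" _ "\<lambda>c. \<Sum>i\<in>UNIV. c $ i"] by blast
  have indec: "c \<notin> (S - {0}) + T"
  proof
    assume "c \<in> (S - {0}) + T"
    then obtain u v where uv: "c = u + v" "u \<in> S" "u \<noteq> 0" "v \<in> T" by (auto simp: set_plus_def)
    have "(\<Sum>i\<in>UNIV. u $ i) \<noteq> 0" using uv(3) by (auto simp: vec_eq_iff)
    then have "\<not> (\<Sum>i\<in>UNIV. c $ i) \<le> (\<Sum>i\<in>UNIV. v $ i)" by (simp add: uv(1) sum.distrib)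
    then have "v \<in> range \<alpha> + S" using least uv by blast
    then have "c \<in> range \<alpha> + (S + S)"
      using set_plus_intro[OF uv(2) \<open>v \<in> range \<alpha> + S\<close>] uv(1)
      by (simp add: add.left_commute[of S])
    then show False using c by (simp add: submonoid_add_plus_absorb[OF submonoid])
  qed
  have cray: "c \<notin> range \<alpha>"
    using c(2) zero_in by (force simp: set_plus_def)
  define \<tau> :: 'k where "\<tau> = (if M \<le> weight c then 0 else 1)"
  let ?J = "hyperplane_ideal T c \<tau>"
  have "reduction_ideal (semigroup_algebra S) (monomial_span (S - {0})) ?J"
    using n0 by (intro hyperplane_ideal_reduction[OF T(1) zero T(2) _ c(1) indec cray])
      (auto simp: \<tau>_def)
  moreover have "?J \<subseteq> monomial_span T" by (auto simp: hyperplane_ideal_def)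
  ultimately have "?J = monomial_span T"
    using min by (simp add: minimal_reduction_ideal_def)
  then have "monomial c \<in> ?J" using c by simp
  moreover have "c \<noteq> \<alpha> i" for i using cray by auto
  ultimately show False by (auto simp: hyperplane_ideal_def coeff_monomial)
qed

end

section \<open>The semigroup and its minimal generators\<close>

lemma extremal_ray_generator_le:
  assumes b: "b \<in> extremal_ray_generators S" and u: "u \<in> S" "u \<noteq> 0"
    and multiple: "M *s u = k *s b" "0 < M"
  shows "b \<le> u"
proof -
  obtain F where F: "extremal_ray (semigroup_cone S) F" "real_vec b \<in> F"
      and least: "\<And>c. c \<in> S \<Longrightarrow> c \<noteq> 0 \<Longrightarrow> real_vec c \<in> F \<Longrightarrow> b \<le> c"
    using b by (auto simp: extremal_ray_generators_def)
  have "real M * real (u $ i) = real k * real (b $ i)" for i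
    using arg_cong[OF multiple(1), of "\<lambda>w. real (w $ i)"] by simp
  then have "real_vec u = (real k / real M) *\<^sub>R real_vec b"
    using multiple(2) by (simp add: real_vec_def vec_eq_iff field_simps)
  moreover have "conic F" using F by (auto simp: extremal_ray_def conic_conic_hull)
  ultimately have "real_vec u \<in> F" using F by (simp add: conic_def)
  then show ?thesis using least u by blast
qed

lemma minimal_generating_set_nonzero:
  assumes "minimal_generating_set S A"
  shows "0 \<notin> A"
proof
  assume "0 \<in> A"
  have "0 \<in> submonoid_add hull (A - {0})"
    using submonoid_add_hull[of "A - {0}"] by (simp add: submonoid_add_def)
  then have "A \<subseteq> submonoid_add hull (A - {0})"
    using hull_subset[of "A - {0}" submonoid_add] by blast
  then have "submonoid_add hull A \<subseteq> submonoid_add hull (A - {0})"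
    by (rule hull_minimal) (rule submonoid_add_hull)
  moreover have "submonoid_add hull (A - {0}) \<subseteq> submonoid_add hull A"
    by (rule hull_mono) blast
  ultimately show False
    using assms \<open>0 \<in> A\<close> unfolding minimal_generating_set_def by blast
qed

lemma generators_plus_hull:
  fixes A :: "(nat ^ 'd) set"
  assumes "0 \<notin> A"
  shows "A + submonoid_add hull A = submonoid_add hull A - {0}"
proof
  let ?S = "submonoid_add hull A"
  have S: "submonoid_add ?S" by (rule submonoid_add_hull)
  have "A \<subseteq> ?S" by (rule hull_subset)
  then have "A + ?S \<subseteq> ?S"
    using set_plus_mono2[of A ?S ?S ?S] submonoid_add_plus_absorb[OF S] by simp
  moreover have "0 \<notin> A + ?S" using assms by (auto simp: set_plus_def)
  ultimately show "A + ?S \<subseteq> ?S - {0}" by blast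
  show "?S - {0} \<subseteq> A + ?S"
  proof
    fix b assume "b \<in> ?S - {0}"
    then have "b \<in> ?S" "b \<noteq> 0" by auto
    from this(1) have "b \<in> insert 0 (A + ?S)"
    proof (rule hull_induct)
      have "0 \<in> ?S" using S by (simp add: submonoid_add_def)
      then show "x \<in> insert 0 (A + ?S)" if "x \<in> A" for x
        using set_plus_intro[OF that, of 0 ?S] by simp
      have "(A + ?S) + (A + ?S) \<subseteq> A + ?S"
        using set_plus_mono2[OF order_refl[of A], of "?S + (A + ?S)" ?S] \<open>A + ?S \<subseteq> ?S\<close>
          set_plus_mono2[of ?S ?S "A + ?S" ?S] submonoid_add_plus_absorb[OF S]
        by (simp add: add.assoc)
      then show "submonoid_add {x. x \<in> insert 0 (A + ?S)}"
        using set_plus_intro[of _ "A + ?S" _ "A + ?S"] unfolding submonoid_add_def by fastforce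
    qed
    then show "b \<in> A + ?S" using \<open>b \<noteq> 0\<close> by simp
  qed
qed

theorem lemma1p4:
  fixes S :: "(nat ^ 'd) set"
    and a :: "nat \<Rightarrow> nat ^ 'd"
    and s :: nat
    and R :: "((nat ^ 'd) \<Rightarrow>\<^sub>0 'k::field) ring"
    and \<mm> E :: "((nat ^ 'd) \<Rightarrow>\<^sub>0 'k) set"
  assumes "affine_semigroup S"
    and "fully_embedded S"
    and "simplicial_semigroup S"
    and "inj_on a {1..CARD('d) + s}"
    and "minimal_generating_set S (a ` {1..CARD('d) + s})"
    and "a ` {1..CARD('d)} = extremal_ray_generators S"
    and "R = monomial_algebra (a ` {1..CARD('d) + s})"
    and "\<mm> = Idl\<^bsub>R\<^esub> (monomial ` a ` {1..CARD('d) + s})"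
    and "E = Idl\<^bsub>R\<^esub> (monomial ` a ` {1..CARD('d)})"
  shows "(reduction_ideal R \<mm> E \<longrightarrow> minimal_reduction_ideal R \<mm> E) \<and>
    (infinite (UNIV :: 'k set) \<longrightarrow>
      (\<forall>J. monomial_ideal S R J \<and> minimal_reduction_ideal R \<mm> J \<longrightarrow> J = E))"
proof -
  define A where "A = a ` {1..CARD('d) + s}"
  have A: "finite A" "0 \<notin> A" "S = submonoid_add hull A"
    using minimal_generating_set_nonzero[OF assms(5)] assms(5)
    by (simp_all add: A_def minimal_generating_set_def)
  have S: "submonoid_add S" unfolding A(3) by (rule submonoid_add_hull)
  obtain e :: "'d \<Rightarrow> nat" where e: "bij_betw e UNIV {1..CARD('d)}"
    using ex_bij_betw_finite_nat[of "UNIV :: 'd set"]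
    by (metis bij_betw_trans card_atLeastAtMost diff_Suc_1 finite finite_atLeastAtMost finite_same_card_bij)
  define \<alpha> where "\<alpha> = a \<circ> e"
  have \<alpha>: "range \<alpha> = extremal_ray_generators S"
    using e assms(6) unfolding \<alpha>_def by (metis bij_betw_imp_surj_on image_comp)
  obtain M q where M: "0 < M"
    and q: "\<And>u v i. u \<in> S \<Longrightarrow> v \<in> S \<Longrightarrow> q (u + v) i = q u i + q v i"
      "\<And>i j. q (\<alpha> i) j = (if i = j then M else 0)"
      "\<And>b. b \<in> S \<Longrightarrow> M *s b = (\<Sum>i\<in>UNIV. q b i *s \<alpha> i)"
    using simplicial_coordinates[OF A assms(2) \<alpha>] by blast
  interpret ray_coordinates S \<alpha> M q
  proof
    show "\<alpha> i \<in> S" for i using \<alpha> by (auto simp: extremal_ray_generators_def)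
    fix u i assume u: "u \<in> S" "u \<noteq> 0" and off: "\<And>j. j \<noteq> i \<Longrightarrow> q u j = 0"
    have "(\<Sum>j\<in>UNIV. q u j *s \<alpha> j) = (\<Sum>j\<in>UNIV. if j = i then q u i *s \<alpha> i else 0)"
      by (rule sum.cong) (auto simp: off vec_eq_iff)
    also have "\<dots> = q u i *s \<alpha> i" by simp
    finally have "M *s u = q u i *s \<alpha> i" unfolding q(3)[OF u(1)] .
    moreover have "\<alpha> i \<in> extremal_ray_generators S" using \<alpha> by blast
    ultimately show "\<alpha> i \<le> u" using u M extremal_ray_generator_le by blast
  qed (fact S M q)+
  have R: "R = semigroup_algebra S"
    using assms(7) by (simp add: monomial_algebra_eq_semigroup_algebra A(3) A_def)
  have "A \<subseteq> S" unfolding A(3) by (rule hull_subset)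
  then have \<mm>: "\<mm> = monomial_span (S - {0})"
    using generators_plus_hull[OF A(2)] genideal_monomials[OF S, of A]
    unfolding assms(8) R A_def[symmetric] A(3)[symmetric] by simp
  have "a ` {1..CARD('d)} = range \<alpha>" using assms(6) \<alpha> by simp
  then have E: "E = monomial_span (range \<alpha> + S)"
    using genideal_monomials[OF S, of "range \<alpha>"] ray_in unfolding assms(9) R by (simp add: image_subset_iff)
  show ?thesis
  proof (intro conjI impI allI)
    assume "reduction_ideal R \<mm> E"
    then show "minimal_reduction_ideal R \<mm> E"
      using rays_ideal_minimal unfolding R \<mm> E minimal_reduction_ideal_def by blast
  next
    fix J assume J: "monomial_ideal S R J \<and> minimal_reduction_ideal R \<mm> J"
    then obtain B where B: "B \<subseteq> S" "J = monomial_span (B + S)"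
      using genideal_monomials[OF S] by (auto simp: monomial_ideal_def R)
    have "B + S \<subseteq> S" "S + (B + S) \<subseteq> B + S"
      using submonoid_add_plus_absorb[OF S] set_plus_mono2[OF B(1), of S S]
      by (simp_all add: add.left_commute)
    then have "B + S = range \<alpha> + S"
      using J B(2) unfolding R \<mm> by (intro monomial_minimal_reduction_eq_rays_ideal[where 'k = 'k]) auto
    then show "J = E" by (simp add: B E)
  qed
qed

end
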